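(* Let $S,T$ be totally irreducible automorphisms of the torus $\mathbb{T}^d=\mathbb{R}^d/\mathbb{Z}^d$ (induced by matrices in $\mathrm{GL}_d(\mathbb{Z})$). Assume that $V_S^{0-}=V_T^{0-}$ and that $\gcd(d,\dim V_S^{0-})=1$ (which holds e.g. if $d$ is prime). Then $S$ and $T$ commute.
   Context: A $d\times d$ integer matrix is irreducible if its characteristic polynomial is irreducible over $\mathbb{Q}$; it is totally irreducible if every power of it is irreducible. An automorphism of $\mathbb{T}^d$ is identified with the matrix in $\mathrm{GL}_d(\mathbb{Z})$ inducing it, which also acts linearly on $\mathbb{R}^d$. For such a matrix $T$ (diagonalizable over $\mathbb{C}$), a generalized eigenspace is either a real one-dimensional eigenspace or the real two-dimensional invariant subspace of $\mathbb{R}^d$ corresponding to a pair of complex conjugate non-real eigenvalues. The weak stable subspace $V_T^{0-}\subseteq\mathbb{R}^d$ is the sum of all generalized eigenspaces of $T$ for eigenvalues $\nu$ with $|\nu|\le 1$. Here $\dim V_S^{0-}$ is the linear dimension. *)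

theory Defs
  imports
    Complex_Main
    "HOL-Computational_Algebra.Polynomial_Factorial"
    "Jordan_Normal_Form.Char_Poly"
    "Jordan_Normal_Form.VS_Connect"
begin

definition GL_int :: "nat \<Rightarrow> int mat set" where
  "GL_int d = {A \<in> carrier_mat d d. invertible_mat A}"

definition irreducible_int_mat :: "int mat \<Rightarrow> bool" where
  "irreducible_int_mat A \<longleftrightarrow>
     Factorial_Ring.irreducible (map_poly rat_of_int (char_poly A))"

text \<open>The power \<open>k = 0\<close> is excluded: it is the identity matrix, which is reducible
  for every \<open>d \<ge> 2\<close>.  Negative powers of invertible matrices need not be listed: the
  characteristic polynomial of an inverse is, up to a unit, the reciprocal polynomial, so it is
  irreducible iff the original one is.\<close>
definition totally_irreducible :: "int mat \<Rightarrow> bool" where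
  "totally_irreducible A \<longleftrightarrow> (\<forall>k\<ge>1. irreducible_int_mat (A ^\<^sub>m k))"

text \<open>For an eigenvalue \<open>\<nu> \<in> \<real>\<close>, the real eigenspace; for an eigenvalue \<open>\<nu> \<notin> \<real>\<close>, the
  vectors of \<open>\<real>^d\<close> whose complexification lies in the sum of the complex eigenspaces of \<open>\<nu>\<close> and of
  its conjugate.  If the eigenvalue is simple, as is every eigenvalue of an irreducible
  matrix, this has dimension 1 in the first case and 2 in the second.\<close>
definition gen_eigenspace :: "int mat \<Rightarrow> complex \<Rightarrow> real vec set" where
  "gen_eigenspace A \<nu> =
     (if \<nu> \<in> \<real>
      then {v \<in> carrier_vec (dim_row A).
              map_mat real_of_int A *\<^sub>v v = Re \<nu> \<cdot>\<^sub>v v}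
      else {v \<in> carrier_vec (dim_row A).
              \<exists>u \<in> carrier_vec (dim_row A). \<exists>w \<in> carrier_vec (dim_row A).
                map_mat complex_of_int A *\<^sub>v u = \<nu> \<cdot>\<^sub>v u \<and>
                map_mat complex_of_int A *\<^sub>v w = cnj \<nu> \<cdot>\<^sub>v w \<and>
                map_vec complex_of_real v = u + w})"

text \<open>The sum of a family of subspaces is expressed as the linear span of their union.\<close>
definition weak_stable :: "int mat \<Rightarrow> real vec set" where
  "weak_stable A =
     LinearCombinations.module.span class_ring (module_vec TYPE(real) (dim_row A))
       (\<Union>\<nu> \<in> {\<nu>. eigenvalue (map_mat complex_of_int A) \<nu> \<and> cmod \<nu> \<le> 1}. gen_eigenspace A \<nu>)"

definition subspace_dim :: "nat \<Rightarrow> real vec set \<Rightarrow> nat" where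
  "subspace_dim d W =
     vectorspace.dim class_ring ((module_vec TYPE(real) d)\<lparr>carrier := W\<rparr>)"

end

(* Over C the matrix S is diagonal in eigenvectors v(z) whose entries are integer polynomials in the
   eigenvalue z, and likewise for its left eigenvectors w(y).  The matrices M that keep
   V = V_S^{0-} invariant have w(y) M v(z) = 0 whenever |y| > 1 >= |z|.  Let R(y, z) hold if
   w(y) M v(z) is nonzero for some integer M with this property; R is reflexive and transitive.
   Since the characteristic polynomial is irreducible, all eigenvalues y satisfy the same rational
   polynomial equations, so the number r of z with R(y, z) does not depend on y.  A preorder
   with this property is an equivalence relation whose classes all have size r.  The eigenvalues with
   |y| > 1 form a union of classes, so r divides both d and d - dim V, whence r = 1.  As T keeps V
   invariant, it is then diagonal in the eigenbasis of S.

   If d is prime, 0 < dim V because the eigenvalues have product of modulus 1, and dim V < d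
   because otherwise the powers of S would be bounded, so some power would be the identity. *)
theory Submission
  imports Defs "HOL-Computational_Algebra.Field_as_Ring" "Jordan_Normal_Form.DL_Rank"
begin

section \<open>Integer polynomials at the roots of an irreducible polynomial\<close>

text \<open>Quantities attached to an eigenvalue are kept as integer polynomials and only then
  evaluated at \<open>z\<close>, so that an algebraic equation at one eigenvalue can be carried over
  to all others.\<close>

definition ev :: "complex \<Rightarrow> int poly \<Rightarrow> complex" where
  "ev z p = poly (map_poly of_int p) z"

lemma ev_hom: "comm_ring_hom (ev z)"
  by unfold_locales (auto simp: ev_def hom_distribs)

global_interpretation ev: comm_ring_hom "ev z" for z
  by (rule ev_hom)

lemma ev_pCons [simp]: "ev z (pCons a p) = of_int a + z * ev z p"
  by (cases "p = 0 \<and> a = 0") (auto simp: ev_def)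

lemma ev_cnj: "ev (cnj z) p = cnj (ev z p)"
  by (induction p) (auto simp: )

lemma ev_rat: "ev z p = poly (map_poly of_rat (map_poly rat_of_int p)) z"
  by (simp add: ev_def map_poly_map_poly o_def)

interpretation of_rat_poly: map_poly_comm_ring_hom "of_rat :: rat \<Rightarrow> complex" ..

text \<open>Over the rationals an irreducible polynomial that does not divide another one is coprime
  to it, and a Bezout identity a f + b p = 1 would read 0 = 1 at the common root.\<close>

lemma dvd_if_common_root:
  assumes irr: "Factorial_Ring.irreducible (map_poly rat_of_int f)"
    and f: "ev z f = 0" and p: "ev z p = 0"
  shows "map_poly rat_of_int f dvd map_poly rat_of_int p"
proof (rule ccontr)
  let ?f = "map_poly rat_of_int f" and ?p = "map_poly rat_of_int p"
  assume "\<not> ?f dvd ?p"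
  moreover have "prime_elem ?f"
    using irr by (rule field_poly_irreducible_imp_prime)
  ultimately have "coprime ?f ?p"
    by (rule prime_elem_imp_coprime[rotated])
  then obtain a b where "a * ?f + b * ?p = 1"
    using bezout_coefficients_fst_snd[of ?f ?p] by (metis coprime_iff_gcd_eq_1)
  then have "poly (map_poly of_rat (a * ?f + b * ?p)) z = (1 :: complex)"
    by simp
  then have "poly (map_poly of_rat a) z * ev z f + poly (map_poly of_rat b) z * ev z p = 1"
    by (simp add: ev_rat of_rat_poly.hom_add of_rat_poly.hom_mult)
  then show False using f p by simp
qed

text \<open>This takes the place of a Galois action: every integer polynomial vanishing at one root
  is a rational multiple of \<open>f\<close>, hence vanishes at all roots.\<close>

lemma ev_eq_0_transfer:
  assumes "Factorial_Ring.irreducible (map_poly rat_of_int f)"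
    and "ev z f = 0" and "ev y f = 0" and "ev z p = 0"
  shows "ev y p = 0"
proof -
  obtain q where "map_poly rat_of_int p = map_poly rat_of_int f * q"
    using dvd_if_common_root[OF assms(1,2,4)] by (rule dvdE)
  then show ?thesis
    using assms(3) by (simp add: ev_rat of_rat_poly.hom_add of_rat_poly.hom_mult)
qed

lemma ev_neq_0_if_degree_less:
  assumes "Factorial_Ring.irreducible (map_poly rat_of_int f)"
    and "ev z f = 0" and "degree p < degree f" and "p \<noteq> 0"
  shows "ev z p \<noteq> 0"
proof
  assume "ev z p = 0"
  with assms(1,2) have "map_poly rat_of_int f dvd map_poly rat_of_int p"
    by (rule dvd_if_common_root)
  moreover have "map_poly rat_of_int p \<noteq> 0" using assms(4) by simp
  ultimately have "degree (map_poly rat_of_int f) \<le> degree (map_poly rat_of_int p)"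
    by (rule dvd_imp_degree_le)
  with assms(3) show False by simp
qed

text \<open>A Vandermonde argument: by linearity the powers may be replaced by any polynomial, in
  particular by one whose roots are the elements of \<open>L\<close> other than
  \<open>y\<close>.\<close>

lemma power_sums_eq_0_imp:
  fixes c :: "'a :: field \<Rightarrow> 'a"
  assumes "finite L" and "\<And>k. (\<Sum>x\<in>L. c x * x ^ k) = 0" and "y \<in> L"
  shows "c y = 0"
proof -
  have *: "(\<Sum>x\<in>L. c x * poly p x) = 0" for p
  proof -
    have "(\<Sum>x\<in>L. c x * poly p x) = (\<Sum>i\<le>degree p. coeff p i * (\<Sum>x\<in>L. c x * x ^ i))"
      by (subst poly_altdef, subst sum_distrib_left, subst sum.swap)
         (simp add: sum_distrib_left ac_simps)
    then show ?thesis using assms(2) by simp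
  qed
  define p where "p = (\<Prod>x\<in>L - {y}. [:- x, 1:])"
  have "(\<Sum>x\<in>L. c x * poly p x) = c y * poly p y + (\<Sum>x\<in>L - {y}. c x * poly p x)"
    using assms(1,3) by (rule sum.remove)
  also have "(\<Sum>x\<in>L - {y}. c x * poly p x) = 0"
    using assms(1) by (intro sum.neutral) (auto simp: p_def poly_prod)
  finally have "c y * poly p y = 0" using * by simp
  moreover have "poly p y \<noteq> 0" using assms(1) by (auto simp: p_def poly_prod)
  ultimately show ?thesis by simp
qed

text \<open>If (x, y) is in \<open>R\<close>, transitivity puts the row of y inside the row of x,
  and equal sizes force equality. Rows that meet are therefore equal, so the rows of elements of
  \<open>J\<close> partition \<open>J\<close> into blocks of size \<open>r\<close>.\<close>

lemma dvd_card_closed_set: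
  assumes "finite L" and R: "R \<subseteq> L \<times> L" "\<And>x. x \<in> L \<Longrightarrow> (x, x) \<in> R" "trans R"
    and r: "\<And>x. x \<in> L \<Longrightarrow> card (R `` {x}) = r"
    and J: "J \<subseteq> L" "\<And>x. x \<in> J \<Longrightarrow> R `` {x} \<subseteq> J"
  shows "r dvd card J"
proof -
  have fin: "finite (R `` {x})" for x
    using R(1) \<open>finite L\<close> by (auto intro: finite_subset[of _ L])
  have eq: "R `` {y} = R `` {x}" if "(x, y) \<in> R" for x y
  proof (rule card_subset_eq)
    show "R `` {y} \<subseteq> R `` {x}" using that \<open>trans R\<close> by (auto dest: transD)
    show "card (R `` {y}) = card (R `` {x})" using that r R(1) by auto
  qed (rule fin)
  define C where "C = (\<lambda>x. R `` {x}) ` J"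
  have "finite J" using J(1) \<open>finite L\<close> by (rule finite_subset)
  have UC: "\<Union>C = J" unfolding C_def using J R(2) by blast
  have "r * card C = card (\<Union>C)"
  proof (rule card_partition)
    show "finite C" "finite (\<Union>C)" using \<open>finite J\<close> UC by (auto simp: C_def)
    show "card c = r" if "c \<in> C" for c using that J(1) r by (auto simp: C_def)
    show "c1 \<inter> c2 = {}" if c: "c1 \<in> C" "c2 \<in> C" "c1 \<noteq> c2" for c1 c2
    proof (rule ccontr)
      assume "c1 \<inter> c2 \<noteq> {}"
      then obtain z where "z \<in> c1" "z \<in> c2" by blast
      then obtain x y where "c1 = R `` {x}" "c2 = R `` {y}" "(x, z) \<in> R" "(y, z) \<in> R"
        using c by (auto simp: C_def)
      with eq[of x z] eq[of y z] c(3) show False by metis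
    qed
  qed
  then show ?thesis using UC by (metis dvd_triv_left)
qed

section \<open>Eigenvectors with polynomial entries\<close>

locale irreducible_matrix =
  fixes d :: nat and S :: "int mat"
  assumes S: "S \<in> carrier_mat d d" and irr: "irreducible_int_mat S"
begin

definition spectrum :: "complex set" where
  "spectrum = {z. ev z (char_poly S) = 0}"

definition adj :: "int poly mat" where
  "adj = adj_mat (char_poly_matrix S)"

text \<open>Since \<open>(x I - S) adj = adj (x I - S) = char_poly S\<close>, a column and a row of \<open>adj\<close>, evaluated at
  an eigenvalue, are a right and a left eigenvector.\<close>

definition v :: "nat \<Rightarrow> complex \<Rightarrow> complex" where
  "v i z = ev z (adj $$ (i, 0))"

definition w :: "nat \<Rightarrow> complex \<Rightarrow> complex" where
  "w i z = ev z (adj $$ (0, i))"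

lemma irr': "Factorial_Ring.irreducible (map_poly rat_of_int (char_poly S))"
  using irr by (simp add: irreducible_int_mat_def)

lemma degree_char_poly: "degree (char_poly S) = d" and monic_char_poly: "coeff (char_poly S) d = 1"
  using degree_monic_char_poly[OF S] by auto

text \<open>For \<open>d = 0\<close> the characteristic polynomial is the unit \<open>1\<close>,
  which is not irreducible.\<close>

lemma d_pos: "d > 0"
proof (rule ccontr)
  assume "\<not> 0 < d"
  then have "char_poly S = 1"
    using degree_char_poly monic_char_poly by (auto elim!: degree_eq_zeroE simp: one_pCons)
  with irr' show False by simp
qed

lemma spectrum_altdef: "spectrum = {z. poly (map_poly of_int (char_poly S)) z = 0}"
  by (simp add: spectrum_def ev_def)

lemma finite_spectrum [simp]: "finite spectrum"
proof -
  have "char_poly S \<noteq> 0" using monic_char_poly by auto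
  then show ?thesis unfolding spectrum_altdef by (intro poly_roots_finite) simp
qed

lemma ev_neq_0: "z \<in> spectrum \<Longrightarrow> degree p < d \<Longrightarrow> p \<noteq> 0 \<Longrightarrow> ev z p \<noteq> 0"
  using ev_neq_0_if_degree_less[OF irr'] by (auto simp: spectrum_def degree_char_poly)

lemma ev_transfer: "z \<in> spectrum \<Longrightarrow> y \<in> spectrum \<Longrightarrow> ev z p = 0 \<longleftrightarrow> ev y p = 0"
  using ev_eq_0_transfer[OF irr', of z y p] ev_eq_0_transfer[OF irr', of y z p]
  by (auto simp: spectrum_def)

text \<open>The derivative is nonzero of degree below \<open>d\<close>, so it cannot vanish at a
  root of the irreducible polynomial \<open>char_poly S\<close>.\<close>

lemma rsquarefree_char_poly: "rsquarefree (map_poly complex_of_int (char_poly S))"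
proof -
  have "pderiv (char_poly S) \<noteq> 0"
    using d_pos degree_char_poly by (auto simp: pderiv_eq_0_iff)
  moreover have "degree (pderiv (char_poly S)) < d"
    using d_pos degree_char_poly by (simp add: degree_pderiv)
  ultimately have "ev z (pderiv (char_poly S)) \<noteq> 0" if "z \<in> spectrum" for z
    using ev_neq_0 that by blast
  then show ?thesis
    unfolding rsquarefree_roots by (auto simp: spectrum_altdef ev_def of_int_hom.map_poly_pderiv)
qed

lemma card_spectrum: "card spectrum = d"
  using rsquarefree_card_degree rsquarefree_char_poly
  unfolding spectrum_altdef by (auto simp: degree_char_poly rsquarefree_def)

lemma cnj_spectrum: "z \<in> spectrum \<Longrightarrow> cnj z \<in> spectrum"
  by (simp add: spectrum_def ev_cnj)

lemma v_cnj: "v i (cnj z) = cnj (v i z)"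
  by (simp add: v_def ev_cnj)

lemma ev_char_poly_matrix:
  assumes "i < d" "j < d"
  shows "ev z (char_poly_matrix S $$ (i, j)) = (if i = j then z else 0) - of_int (S $$ (i, j))"
proof -
  have "char_poly_matrix S $$ (i, j) = (if i = j then [:0, 1:] else 0) + [:- (S $$ (i, j)):]"
    using S assms by (auto simp: char_poly_matrix_def)
  then show ?thesis by (simp add: ev.hom_add)
qed

lemma adj_carrier: "adj \<in> carrier_mat d d"
  unfolding adj_def by (rule adj_mat(1)[OF char_poly_matrix_closed[OF S]])

lemma right_eigenvector:
  assumes z: "z \<in> spectrum" and i: "i < d"
  shows "(\<Sum>j<d. of_int (S $$ (i, j)) * v j z) = z * v i z"
proof -
  note C = char_poly_matrix_closed[OF S]
  have "(char_poly_matrix S * adj) $$ (i, 0) = (char_poly S \<cdot>\<^sub>m 1\<^sub>m d) $$ (i, 0)"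
    by (simp only: adj_def char_poly_def adj_mat(2)[OF C])
  also have "(char_poly_matrix S * adj) $$ (i, 0) = (\<Sum>j<d. char_poly_matrix S $$ (i, j) * adj $$ (j, 0))"
    using i d_pos adj_carrier C by (simp add: scalar_prod_def atLeast0LessThan)
  finally have "ev z (\<Sum>j<d. char_poly_matrix S $$ (i, j) * adj $$ (j, 0)) = 0"
    using i d_pos z by (simp add: spectrum_def ev.hom_mult)
  then have "(\<Sum>j<d. ((if i = j then z else 0) - of_int (S $$ (i, j))) * v j z) = 0"
    using i by (simp add: ev.hom_sum ev.hom_mult ev_char_poly_matrix v_def)
  moreover have "(\<Sum>j<d. ((if i = j then z else 0) - of_int (S $$ (i, j))) * v j z) =
      (\<Sum>j<d. if i = j then z * v j z else 0) - (\<Sum>j<d. of_int (S $$ (i, j)) * v j z)"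
    unfolding sum_subtractf[symmetric] by (intro sum.cong) (auto simp: algebra_simps)
  ultimately show ?thesis using i by simp
qed

lemma left_eigenvector:
  assumes z: "z \<in> spectrum" and j: "j < d"
  shows "(\<Sum>i<d. w i z * of_int (S $$ (i, j))) = z * w j z"
proof -
  note C = char_poly_matrix_closed[OF S]
  have "(adj * char_poly_matrix S) $$ (0, j) = (char_poly S \<cdot>\<^sub>m 1\<^sub>m d) $$ (0, j)"
    by (simp only: adj_def char_poly_def adj_mat(3)[OF C])
  also have "(adj * char_poly_matrix S) $$ (0, j) = (\<Sum>i<d. adj $$ (0, i) * char_poly_matrix S $$ (i, j))"
    using j d_pos adj_carrier C by (simp add: scalar_prod_def atLeast0LessThan)
  finally have "ev z (\<Sum>i<d. adj $$ (0, i) * char_poly_matrix S $$ (i, j)) = 0"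
    using j d_pos z by (simp add: spectrum_def ev.hom_mult)
  then have "(\<Sum>i<d. w i z * ((if i = j then z else 0) - of_int (S $$ (i, j)))) = 0"
    using j by (simp add: ev.hom_sum ev.hom_mult ev_char_poly_matrix w_def)
  moreover have "(\<Sum>i<d. w i z * ((if i = j then z else 0) - of_int (S $$ (i, j)))) =
      (\<Sum>i<d. if i = j then z * w i z else 0) - (\<Sum>i<d. w i z * of_int (S $$ (i, j)))"
    unfolding sum_subtractf[symmetric] by (intro sum.cong) (auto simp: algebra_simps)
  ultimately show ?thesis using j by simp
qed

text \<open>The entry of \<open>adj\<close> at (0, 0) is the characteristic polynomial of
  \<open>S\<close> with row and column 0 deleted. It is monic of degree \<open>d - 1\<close>, too
  small to vanish at an eigenvalue. So column 0 and row 0 of \<open>adj\<close> give nonzero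
  eigenvectors.\<close>

lemma v_0_neq_0: "z \<in> spectrum \<Longrightarrow> v 0 z \<noteq> 0"
  and w_0_neq_0: "z \<in> spectrum \<Longrightarrow> w 0 z \<noteq> 0"
proof -
  have del: "mat_delete S 0 0 \<in> carrier_mat (d - 1) (d - 1)"
    using S by (rule mat_delete_carrier)
  have "mat_delete (char_poly_matrix S) 0 0 = char_poly_matrix (mat_delete S 0 0)"
    by (rule eq_matI) (use S in \<open>auto simp: mat_delete_def char_poly_matrix_def\<close>)
  then have "adj $$ (0, 0) = char_poly (mat_delete S 0 0)"
    using S d_pos by (simp add: adj_def adj_mat_def cofactor_def char_poly_def char_poly_matrix_def)
  then have "degree (adj $$ (0, 0)) = d - 1" "adj $$ (0, 0) \<noteq> 0"
    using degree_monic_char_poly[OF del] by auto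
  then show "z \<in> spectrum \<Longrightarrow> v 0 z \<noteq> 0" "z \<in> spectrum \<Longrightarrow> w 0 z \<noteq> 0"
    using ev_neq_0 d_pos unfolding v_def w_def by auto
qed

section \<open>Biorthogonality of left and right eigenvectors\<close>

definition pairing :: "complex \<Rightarrow> complex" where
  "pairing z = (\<Sum>i<d. w i z * v i z)"

text \<open>In w(y) S v(z) the matrix acts on the left factor as y and on the right factor as
  z.\<close>

lemma pairing_eq_0:
  assumes y: "y \<in> spectrum" and z: "z \<in> spectrum" and "y \<noteq> z"
  shows "(\<Sum>i<d. w i y * v i z) = 0"
proof -
  have "y * (\<Sum>j<d. w j y * v j z) = (\<Sum>j<d. (\<Sum>i<d. w i y * of_int (S $$ (i, j))) * v j z)"
    using y by (simp add: left_eigenvector sum_distrib_left mult.assoc)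
  also have "\<dots> = (\<Sum>i<d. w i y * (\<Sum>j<d. of_int (S $$ (i, j)) * v j z))"
    by (simp only: sum_distrib_left sum_distrib_right mult.assoc) (rule sum.swap)
  also have "\<dots> = (\<Sum>i<d. w i y * (z * v i z))"
    using z by (simp add: right_eigenvector)
  also have "\<dots> = z * (\<Sum>j<d. w j y * v j z)"
    by (simp add: sum_distrib_left ac_simps)
  finally show ?thesis using \<open>y \<noteq> z\<close> by simp
qed

text \<open>Applying powers of \<open>S\<close> to the relation multiplies each term by a power of
  its eigenvalue. Component 0 alone then gives vanishing power sums, and \<open>v 0 z\<close> is
  nonzero.\<close>

lemma right_eigenvectors_independent:
  assumes c: "\<And>i. i < d \<Longrightarrow> (\<Sum>z\<in>spectrum. c z * v i z) = 0" and z: "z \<in> spectrum"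
  shows "c z = 0"
proof -
  have "\<forall>i<d. (\<Sum>z\<in>spectrum. c z * z ^ k * v i z) = 0" for k
  proof (induction k)
    case 0
    then show ?case using c by simp
  next
    case (Suc k)
    show ?case
    proof (intro allI impI)
      fix i assume "i < d"
      have "(\<Sum>z\<in>spectrum. c z * z ^ Suc k * v i z) =
          (\<Sum>z\<in>spectrum. c z * z ^ k * (\<Sum>j<d. of_int (S $$ (i, j)) * v j z))"
        using \<open>i < d\<close> by (intro sum.cong) (simp_all add: right_eigenvector)
      also have "\<dots> = (\<Sum>j<d. of_int (S $$ (i, j)) * (\<Sum>z\<in>spectrum. c z * z ^ k * v j z))"
        unfolding sum_distrib_left by (subst sum.swap) (simp add: ac_simps)
      finally show "(\<Sum>z\<in>spectrum. c z * z ^ Suc k * v i z) = 0"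
        using Suc.IH by simp
    qed
  qed
  then have "(\<Sum>z\<in>spectrum. (c z * v 0 z) * z ^ k) = 0" for k
    using d_pos by (simp add: ac_simps)
  then have "c z * v 0 z = 0"
    using z power_sums_eq_0_imp[of spectrum "\<lambda>z. c z * v 0 z" z] by simp
  then show ?thesis using v_0_neq_0[OF z] by simp
qed

lemma spectrum_enumeration: "\<exists>e. bij_betw e {..<d} spectrum"
  using ex_bij_betw_nat_finite[OF finite_spectrum] by (simp add: card_spectrum atLeast0LessThan)

lemma det_eigenvector_matrix:
  assumes e: "bij_betw e {..<d} spectrum"
  shows "det (mat d d (\<lambda>(i, j). v i (e j))) \<noteq> 0"
proof
  let ?B = "mat d d (\<lambda>(i, j). v i (e j))"
  assume "det ?B = 0"
  then obtain x where x: "x \<in> carrier_vec d" "x \<noteq> 0\<^sub>v d" "?B *\<^sub>v x = 0\<^sub>v d"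
    using det_0_iff_vec_prod_zero[of ?B d] by auto
  define c where "c z = x $ the_inv_into {..<d} e z" for z
  have ce: "c (e j) = x $ j" if "j < d" for j
    using that e by (simp add: c_def the_inv_into_f_f bij_betw_def)
  have "(\<Sum>z\<in>spectrum. c z * v i z) = 0" if "i < d" for i
  proof -
    have "(\<Sum>z\<in>spectrum. c z * v i z) = (\<Sum>j<d. c (e j) * v i (e j))"
      by (rule sum.reindex_bij_betw[OF e, symmetric])
    also have "\<dots> = (?B *\<^sub>v x) $ i"
      using that x(1) by (simp add: scalar_prod_def ce atLeast0LessThan mult.commute)
    finally show ?thesis using x(3) that by simp
  qed
  then have "c z = 0" if "z \<in> spectrum" for z
    using right_eigenvectors_independent that by blast
  then have "x $ j = 0" if "j < d" for j
    using ce that e by (metis bij_betwE lessThan_iff)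
  then have "x = 0\<^sub>v d" using x(1) by (intro eq_vecI) auto
  with x(2) show False ..
qed

text \<open>Otherwise w(z) would be orthogonal to every right eigenvector; these form a basis, so
  w(z) would be zero, against \<open>w_0_neq_0\<close>.\<close>

lemma pairing_neq_0:
  assumes z: "z \<in> spectrum"
  shows "pairing z \<noteq> 0"
proof
  assume 0: "pairing z = 0"
  obtain e where e: "bij_betw e {..<d} spectrum" using spectrum_enumeration ..
  let ?B = "mat d d (\<lambda>(i, j). v i (e j))"
  let ?w = "vec d (\<lambda>i. w i z)"
  have "?B\<^sup>T *\<^sub>v ?w = 0\<^sub>v d"
  proof (rule eq_vecI)
    fix j assume "j < dim_vec (0\<^sub>v d :: complex vec)"
    then have j: "j < d" "e j \<in> spectrum" using e by (auto simp: bij_betw_def)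
    then have "(\<Sum>i<d. w i z * v i (e j)) = 0"
      using 0 z pairing_eq_0 unfolding pairing_def by metis
    then show "(?B\<^sup>T *\<^sub>v ?w) $ j = 0\<^sub>v d $ j"
      using j by (simp add: scalar_prod_def atLeast0LessThan mult.commute)
  qed simp
  moreover have "?w \<noteq> 0\<^sub>v d"
    using w_0_neq_0[OF z] d_pos by (metis index_vec index_zero_vec(1))
  moreover have "det (?B\<^sup>T) \<noteq> 0"
    using det_eigenvector_matrix[OF e] det_transpose[of ?B d] by simp
  ultimately show False
    using det_0_iff_vec_prod_zero[of "?B\<^sup>T" d] by (metis mat_carrier transpose_carrier_mat vec_carrier)
qed

text \<open>With right eigenvectors as columns of \<open>B\<close> and normalised left eigenvectors
  as rows of \<open>C\<close>, biorthogonality says \<open>C * B = 1\<close>. For square matrices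
  this gives \<open>B * C = 1\<close>, which is the claim.\<close>

lemma resolution_of_identity:
  assumes ij: "i < d" "j < d"
  shows "(\<Sum>z\<in>spectrum. v i z * w j z / pairing z) = (if i = j then 1 else 0)"
proof -
  obtain e where e: "bij_betw e {..<d} spectrum" using spectrum_enumeration ..
  have es: "e k \<in> spectrum" if "k < d" for k using e that by (auto simp: bij_betw_def)
  define B where "B = mat d d (\<lambda>(i, j). v i (e j))"
  define C where "C = mat d d (\<lambda>(k, j). w j (e k) / pairing (e k))"
  have BC: "B \<in> carrier_mat d d" "C \<in> carrier_mat d d" by (simp_all add: B_def C_def)
  have "C * B = 1\<^sub>m d"
  proof (rule eq_matI)
    fix k l assume "k < dim_row (1\<^sub>m d :: complex mat)" "l < dim_col (1\<^sub>m d :: complex mat)"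
    then have kl: "k < d" "l < d" by auto
    then have "(C * B) $$ (k, l) = (\<Sum>i<d. w i (e k) * v i (e l)) / pairing (e k)"
      by (simp add: B_def C_def scalar_prod_def atLeast0LessThan sum_divide_distrib)
    also have "\<dots> = (if k = l then 1 else 0)"
    proof (cases "k = l")
      case True
      then show ?thesis using pairing_neq_0[OF es[OF kl(1)]] by (simp add: pairing_def)
    next
      case False
      then have "e k \<noteq> e l" using e kl by (auto simp: bij_betw_def inj_on_def)
      then show ?thesis using pairing_eq_0 es kl False by simp
    qed
    finally show "(C * B) $$ (k, l) = 1\<^sub>m d $$ (k, l)" using kl by simp
  qed (use BC in auto)
  then have "B * C = 1\<^sub>m d"
    using mat_mult_left_right_inverse BC by blast
  then have "(B * C) $$ (i, j) = (if i = j then 1 else 0)" using ij by simp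
  moreover have "(B * C) $$ (i, j) = (\<Sum>k<d. v i (e k) * w j (e k) / pairing (e k))"
    using ij by (simp add: B_def C_def scalar_prod_def atLeast0LessThan)
  ultimately show ?thesis
    using sum.reindex_bij_betw[OF e, of "\<lambda>z. v i z * w j z / pairing z"] by simp
qed

lemma eigenvector_expansion:
  assumes "i < d"
  shows "x i = (\<Sum>z\<in>spectrum. (\<Sum>j<d. w j z * x j) / pairing z * v i z)"
proof -
  have "x i = (\<Sum>j<d. (if i = j then 1 else 0) * x j)"
    using assms by (simp add: if_distrib[of "\<lambda>y. y * x _"] cong: if_cong)
  also have "\<dots> = (\<Sum>j<d. (\<Sum>z\<in>spectrum. v i z * w j z / pairing z) * x j)"
    using assms by (intro sum.cong) (simp_all add: resolution_of_identity)
  also have "\<dots> = (\<Sum>z\<in>spectrum. (\<Sum>j<d. w j z * x j) / pairing z * v i z)"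
    unfolding sum_distrib_right sum_divide_distrib by (subst sum.swap) (simp add: ac_simps)
  finally show ?thesis .
qed

text \<open>Up to the factor \<open>pairing y\<close>, this is the entry of \<open>M\<close> at
  position (y, z) in the basis of right eigenvectors.\<close>

definition form :: "int mat \<Rightarrow> complex \<Rightarrow> complex \<Rightarrow> complex" where
  "form M y z = (\<Sum>i<d. w i y * (\<Sum>j<d. of_int (M $$ (i, j)) * v j z))"

lemma form_add:
  "M \<in> carrier_mat d d \<Longrightarrow> N \<in> carrier_mat d d \<Longrightarrow> form (M + N) y z = form M y z + form N y z"
  by (simp add: form_def distrib_left distrib_right sum.distrib)

lemma form_smult:
  "M \<in> carrier_mat d d \<Longrightarrow> form (a \<cdot>\<^sub>m M) y z = of_int a * form M y z"
  by (simp add: form_def sum_distrib_left ac_simps)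

lemma mult_index:
  "M \<in> carrier_mat d d \<Longrightarrow> N \<in> carrier_mat d d \<Longrightarrow> i < d \<Longrightarrow> j < d \<Longrightarrow>
    (M * N) $$ (i, j) = (\<Sum>k<d. M $$ (i, k) * N $$ (k, j))"
  by (simp add: scalar_prod_def atLeast0LessThan)

lemma mult_v:
  assumes "M \<in> carrier_mat d d" "N \<in> carrier_mat d d" "i < d"
  shows "(\<Sum>j<d. complex_of_int ((M * N) $$ (i, j)) * x j) =
    (\<Sum>k<d. of_int (M $$ (i, k)) * (\<Sum>j<d. of_int (N $$ (k, j)) * x j))"
proof -
  have "(\<Sum>j<d. complex_of_int ((M * N) $$ (i, j)) * x j) =
      (\<Sum>j<d. \<Sum>k<d. of_int (M $$ (i, k)) * (of_int (N $$ (k, j)) * x j))"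
    using assms by (intro sum.cong) (simp_all add: mult_index sum_distrib_right mult.assoc del: index_mult_mat)
  also have "\<dots> = (\<Sum>k<d. of_int (M $$ (i, k)) * (\<Sum>j<d. of_int (N $$ (k, j)) * x j))"
    unfolding sum_distrib_left by (rule sum.swap)
  finally show ?thesis .
qed

text \<open>Matrix multiplication in the eigenbasis: the resolution of the identity is inserted
  between the two factors, whence the denominators.\<close>

lemma form_mult:
  assumes "M \<in> carrier_mat d d" "N \<in> carrier_mat d d"
  shows "form (M * N) y z = (\<Sum>u\<in>spectrum. form M y u * form N u z / pairing u)"
proof -
  define x where "x k = (\<Sum>j<d. of_int (N $$ (k, j)) * v j z)" for k
  have "form (M * N) y z = (\<Sum>i<d. w i y * (\<Sum>k<d. of_int (M $$ (i, k)) * x k))"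
    using assms by (simp add: form_def mult_v x_def del: index_mult_mat)
  also have "\<dots> = (\<Sum>i<d. w i y * (\<Sum>k<d. of_int (M $$ (i, k)) *
      (\<Sum>u\<in>spectrum. form N u z / pairing u * v k u)))"
    by (intro sum.cong arg_cong2[of _ _ _ _ "(*)"] refl, subst eigenvector_expansion[of _ x])
       (auto simp: form_def x_def)
  also have "\<dots> = (\<Sum>i<d. w i y * (\<Sum>u\<in>spectrum. form N u z / pairing u *
      (\<Sum>k<d. of_int (M $$ (i, k)) * v k u)))"
    unfolding sum_distrib_left
    by (intro sum.cong refl, subst sum.swap) (simp add: ac_simps)
  also have "\<dots> = (\<Sum>u\<in>spectrum. form M y u * form N u z / pairing u)"
    unfolding form_def[of M] sum_distrib_left sum_distrib_right sum_divide_distrib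
    by (subst sum.swap) (simp add: ac_simps sum_distrib_left)
  finally show ?thesis .
qed

lemma form_one: "y \<in> spectrum \<Longrightarrow> z \<in> spectrum \<Longrightarrow> form (1\<^sub>m d) y z = (if y = z then pairing z else 0)"
proof -
  assume "y \<in> spectrum" "z \<in> spectrum"
  have "form (1\<^sub>m d) y z = (\<Sum>i<d. w i y * v i z)"
    unfolding form_def
  proof (intro sum.cong refl, goal_cases)
    case (1 i)
    have "(\<Sum>j<d. of_int (1\<^sub>m d $$ (i, j)) * v j z) = (\<Sum>j<d. if i = j then v j z else 0)"
      using 1 by (intro sum.cong) auto
    then show ?case using 1 by simp
  qed
  then show ?thesis using pairing_eq_0 \<open>y \<in> spectrum\<close> \<open>z \<in> spectrum\<close> by (auto simp: pairing_def)
qed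

lemma form_mult_S:
  assumes "M \<in> carrier_mat d d" "z \<in> spectrum"
  shows "form (M * S) y z = form M y z * z"
proof -
  have "form (M * S) y z = (\<Sum>i<d. w i y * (\<Sum>k<d. of_int (M $$ (i, k)) *
      (\<Sum>j<d. of_int (S $$ (k, j)) * v j z)))"
    using assms S by (simp add: form_def mult_v del: index_mult_mat)
  also have "\<dots> = (\<Sum>i<d. w i y * (\<Sum>k<d. of_int (M $$ (i, k)) * (z * v k z)))"
    using assms by (simp add: right_eigenvector)
  also have "\<dots> = form M y z * z"
    unfolding form_def sum_distrib_left sum_distrib_right by (simp add: ac_simps)
  finally show ?thesis .
qed

lemma form_S_mult:
  assumes "M \<in> carrier_mat d d" "y \<in> spectrum"
  shows "form (S * M) y z = y * form M y z"
proof -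
  have "form (S * M) y z = (\<Sum>i<d. w i y * (\<Sum>k<d. of_int (S $$ (i, k)) *
      (\<Sum>j<d. of_int (M $$ (k, j)) * v j z)))"
    using assms S by (simp add: form_def mult_v del: index_mult_mat)
  also have "\<dots> = (\<Sum>k<d. (\<Sum>i<d. w i y * of_int (S $$ (i, k))) * (\<Sum>j<d. of_int (M $$ (k, j)) * v j z))"
    unfolding sum_distrib_left[of "w _ _"] sum_distrib_right[of _ "{..<d}"]
    by (subst sum.swap) (simp add: mult.assoc)
  also have "\<dots> = y * form M y z"
    using assms by (simp add: left_eigenvector form_def sum_distrib_left mult.assoc)
  finally show ?thesis .
qed

text \<open>For the difference \<open>D\<close>, expanding D v(z) in eigenvectors shows that it is
  zero; as the v(z) span the whole space, \<open>D\<close> is zero.\<close>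

lemma form_eqI:
  assumes MN: "M \<in> carrier_mat d d" "N \<in> carrier_mat d d"
    and eq: "\<And>y z. y \<in> spectrum \<Longrightarrow> z \<in> spectrum \<Longrightarrow> form M y z = form N y z"
  shows "M = N"
proof -
  define D where "D = M - N"
  have D: "D \<in> carrier_mat d d" using MN by (auto simp: D_def)
  have 0: "form D y z = 0" if "y \<in> spectrum" "z \<in> spectrum" for y z
    using eq[OF that] MN by (simp add: D_def form_def left_diff_distrib right_diff_distrib sum_subtractf)
  have 1: "(\<Sum>j<d. of_int (D $$ (i, j)) * v j z) = 0" if "i < d" "z \<in> spectrum" for i z
    using that eigenvector_expansion[of i "\<lambda>i. \<Sum>j<d. of_int (D $$ (i, j)) * v j z"] 0
    by (simp add: form_def)
  have "D $$ (i, j) = 0" if ij: "i < d" "j < d" for i j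
  proof -
    have "(of_int (D $$ (i, j)) :: complex) = (\<Sum>k<d. of_int (D $$ (i, k)) * (if k = j then 1 else 0))"
      using ij by (simp add: if_distrib[of "\<lambda>y. _ * y"] cong: if_cong)
    also have "\<dots> = (\<Sum>k<d. of_int (D $$ (i, k)) * (\<Sum>z\<in>spectrum. v k z * w j z / pairing z))"
      using ij by (intro sum.cong) (simp_all add: resolution_of_identity)
    also have "\<dots> = (\<Sum>z\<in>spectrum. (\<Sum>k<d. of_int (D $$ (i, k)) * v k z) * (w j z / pairing z))"
      unfolding sum_distrib_left sum_distrib_right by (subst sum.swap) (simp add: mult.assoc)
    also have "\<dots> = 0" using ij 1 by simp
    finally show ?thesis by simp
  qed
  then show ?thesis
    using MN by (intro eq_matI) (auto simp: D_def)
qed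

end

section \<open>Zero patterns in the eigenbasis\<close>

text \<open>The zeros of \<open>f\<close> contribute a power of the variable, the other factors a
  nonzero constant term. Thus the number of zeros can be read off from the vanishing of
  coefficients.\<close>

lemma coeff_prod_linear_factors:
  fixes f :: "'a \<Rightarrow> 'b :: field"
  assumes "finite A"
  defines "m \<equiv> card {x \<in> A. f x = 0}"
  shows "k < m \<Longrightarrow> coeff (\<Prod>x\<in>A. [:- f x, 1:]) k = 0"
    and "coeff (\<Prod>x\<in>A. [:- f x, 1:]) m \<noteq> 0"
proof -
  define q where "q = (\<Prod>x\<in>A - {x \<in> A. f x = 0}. [:- f x, 1:])"
  have "(\<Prod>x\<in>A. [:- f x, 1:]) = q * (\<Prod>x\<in>{x \<in> A. f x = 0}. [:- f x, 1:])"
    unfolding q_def using assms(1) by (intro prod.subset_diff) auto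
  also have "(\<Prod>x\<in>{x \<in> A. f x = 0}. [:- f x, 1:]) = monom 1 m"
    by (simp add: m_def monom_altdef)
  finally have eq: "(\<Prod>x\<in>A. [:- f x, 1:]) = monom 1 m * q"
    by (simp add: mult.commute)
  have "poly q 0 \<noteq> 0"
    using assms(1) by (auto simp: q_def poly_prod)
  then show "coeff (\<Prod>x\<in>A. [:- f x, 1:]) m \<noteq> 0"
    by (simp add: eq coeff_monom_mult poly_0_coeff_0)
  show "coeff (\<Prod>x\<in>A. [:- f x, 1:]) k = 0" if "k < m"
    using that by (simp add: eq coeff_monom_mult)
qed

context irreducible_matrix
begin

lemma pow_S_carrier: "S ^\<^sub>m k \<in> carrier_mat d d"
  using S by (rule pow_carrier_mat)

lemma pow_S_right_eigenvector:
  assumes z: "z \<in> spectrum"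
  shows "i < d \<Longrightarrow> (\<Sum>j<d. of_int ((S ^\<^sub>m k) $$ (i, j)) * v j z) = z ^ k * v i z"
proof (induction k arbitrary: i)
  case 0
  have "(\<Sum>j<d. of_int ((S ^\<^sub>m 0) $$ (i, j)) * v j z) = (\<Sum>j<d. if i = j then v j z else 0)"
    using S 0 by (intro sum.cong) auto
  then show ?case using 0 by simp
next
  case (Suc k)
  have "(\<Sum>j<d. of_int ((S ^\<^sub>m Suc k) $$ (i, j)) * v j z) =
      (\<Sum>l<d. of_int ((S ^\<^sub>m k) $$ (i, l)) * (z * v l z))"
    using Suc.prems z by (simp add: mult_v[OF pow_S_carrier S] right_eigenvector del: index_mult_mat)
  also have "\<dots> = z * (z ^ k * v i z)"
    using Suc by (simp add: Suc.IH[symmetric] sum_distrib_left ac_simps)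
  finally show ?case by (simp add: ac_simps)
qed

text \<open>The matrix \<open>\<Sum>\<^sub>j (w(x) M)\<^sub>j v\<^sub>j(S)\<close> with \<open>x\<close> left as the polynomial variable: at \<open>x = y\<close> it
  multiplies the eigenvector \<open>v(z)\<close> by \<open>form M y z\<close>.  The coefficients of its characteristic polynomial
  are integer polynomials in \<open>y\<close>, so they vanish at all eigenvalues \<open>y\<close> or at none.\<close>

definition row_mat :: "int mat \<Rightarrow> int poly mat" where
  "row_mat M = mat d d (\<lambda>(a, b). \<Sum>i<d. adj $$ (0, i) * (\<Sum>j<d. [:M $$ (i, j):] *
     (\<Sum>k\<le>degree (adj $$ (j, 0)). [:coeff (adj $$ (j, 0)) k:] * [:(S ^\<^sub>m k) $$ (a, b):])))"

lemma row_mat_eigenvector: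
  assumes z: "z \<in> spectrum" and a: "a < d"
  shows "(\<Sum>b<d. ev y (row_mat M $$ (a, b)) * v b z) = form M y z * v a z"
proof -
  have v: "(\<Sum>k\<le>degree (adj $$ (j, 0)). of_int (coeff (adj $$ (j, 0)) k) * (z ^ k * x)) = v j z * x" for j x
    by (simp add: v_def ev_def poly_altdef sum_distrib_right mult.assoc)
  have "(\<Sum>b<d. ev y (row_mat M $$ (a, b)) * v b z) =
     (\<Sum>b<d. (\<Sum>i<d. w i y * (\<Sum>j<d. of_int (M $$ (i, j)) * (\<Sum>k\<le>degree (adj $$ (j, 0)).
       of_int (coeff (adj $$ (j, 0)) k) * of_int ((S ^\<^sub>m k) $$ (a, b))))) * v b z)"
    using a by (intro sum.cong refl) (simp add: row_mat_def ev.hom_sum ev.hom_mult w_def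
      del: mult_pCons_left mult_pCons_right)
  also have "\<dots> = (\<Sum>i<d. \<Sum>b<d. w i y * (\<Sum>j<d. of_int (M $$ (i, j)) * (\<Sum>k\<le>degree (adj $$ (j, 0)).
       of_int (coeff (adj $$ (j, 0)) k) * of_int ((S ^\<^sub>m k) $$ (a, b)))) * v b z)"
    unfolding sum_distrib_right by (rule sum.swap)
  also have "\<dots> = (\<Sum>i<d. w i y * (\<Sum>b<d. \<Sum>j<d. of_int (M $$ (i, j)) * (\<Sum>k\<le>degree (adj $$ (j, 0)).
       of_int (coeff (adj $$ (j, 0)) k) * of_int ((S ^\<^sub>m k) $$ (a, b))) * v b z))"
    by (simp add: sum_distrib_left sum_distrib_right mult.assoc)
  also have "\<dots> = (\<Sum>i<d. w i y * (\<Sum>j<d. \<Sum>b<d. of_int (M $$ (i, j)) * (\<Sum>k\<le>degree (adj $$ (j, 0)).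
       of_int (coeff (adj $$ (j, 0)) k) * of_int ((S ^\<^sub>m k) $$ (a, b))) * v b z))"
    by (intro sum.cong arg_cong2[of _ _ _ _ "(*)"] refl sum.swap)
  also have "\<dots> = (\<Sum>i<d. w i y * (\<Sum>j<d. of_int (M $$ (i, j)) * (\<Sum>b<d. \<Sum>k\<le>degree (adj $$ (j, 0)).
       of_int (coeff (adj $$ (j, 0)) k) * of_int ((S ^\<^sub>m k) $$ (a, b)) * v b z)))"
    by (simp add: sum_distrib_left sum_distrib_right mult.assoc)
  also have "\<dots> = (\<Sum>i<d. w i y * (\<Sum>j<d. of_int (M $$ (i, j)) * (\<Sum>k\<le>degree (adj $$ (j, 0)). \<Sum>b<d.
       of_int (coeff (adj $$ (j, 0)) k) * of_int ((S ^\<^sub>m k) $$ (a, b)) * v b z)))"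
    by (intro sum.cong arg_cong2[of _ _ _ _ "(*)"] refl sum.swap)
  \<comment> \<open>The sum over \<open>b\<close> has been moved innermost, where it applies powers
    of \<open>S\<close> to v(z); this turns the matrix v_j(S) into the number v_j(z).\<close>
  also have "\<dots> = (\<Sum>i<d. w i y * (\<Sum>j<d. of_int (M $$ (i, j)) * (\<Sum>k\<le>degree (adj $$ (j, 0)).
       of_int (coeff (adj $$ (j, 0)) k) * (z ^ k * v a z))))"
    by (simp add: pow_S_right_eigenvector[OF z a, symmetric] sum_distrib_left mult.assoc)
  also have "\<dots> = form M y z * v a z"
    unfolding v form_def by (simp add: sum_distrib_left sum_distrib_right mult.assoc)
  finally show ?thesis .
qed

text \<open>The right eigenvectors diagonalise the evaluated matrix, with diagonal entries
  \<open>form M y z\<close>. The left side has coefficients that are values at \<open>y\<close> of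
  integer polynomials independent of \<open>y\<close>.\<close>

lemma char_poly_row_mat:
  "map_poly (ev y) (char_poly (row_mat M)) = (\<Prod>z\<in>spectrum. [:- form M y z, 1:])"
proof -
  obtain e where e: "bij_betw e {..<d} spectrum" using spectrum_enumeration ..
  have es: "e k \<in> spectrum" if "k < d" for k using e that by (auto simp: bij_betw_def)
  define B where "B = mat d d (\<lambda>(i, j). v i (e j))"
  define G where "G = map_mat (ev y) (row_mat M)"
  define D where "D = mat d d (\<lambda>(i, j). if i = j then form M y (e j) else 0)"
  have car: "B \<in> carrier_mat d d" "G \<in> carrier_mat d d" "D \<in> carrier_mat d d"
    by (simp_all add: B_def G_def D_def row_mat_def)
  have GB: "G * B = B * D"
  proof (rule eq_matI)
    fix a l assume "a < dim_row (B * D)" "l < dim_col (B * D)"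
    then have al: "a < d" "l < d" using car by auto
    have "(G * B) $$ (a, l) = (\<Sum>b<d. ev y (row_mat M $$ (a, b)) * v b (e l))"
      using al car by (simp add: scalar_prod_def atLeast0LessThan G_def B_def row_mat_def)
    also have "\<dots> = form M y (e l) * v a (e l)"
      using row_mat_eigenvector[OF es] al by blast
    also have "\<dots> = (\<Sum>b<d. if b = l then v a (e b) * form M y (e b) else 0)"
      using al by simp
    also have "\<dots> = (\<Sum>b<d. v a (e b) * (if b = l then form M y (e l) else 0))"
      by (intro sum.cong) auto
    also have "\<dots> = (B * D) $$ (a, l)"
      using al car by (simp add: scalar_prod_def atLeast0LessThan B_def D_def cong: if_cong)
    finally show "(G * B) $$ (a, l) = (B * D) $$ (a, l)" .
  qed (use car in auto)
  obtain C where C: "C \<in> carrier_mat d d" "B * C = 1\<^sub>m d" "C * B = 1\<^sub>m d"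
    using det_non_zero_imp_unit[OF car(1)] det_eigenvector_matrix[OF e]
    by (auto simp: B_def[symmetric] Units_def ring_mat_def)
  have "G = G * (B * C)" using C car by simp
  also have "\<dots> = B * D * C" using C car by (simp add: GB[symmetric])
  finally have "similar_mat G D"
    using C car unfolding similar_mat_def similar_mat_wit_def Let_def
    by (intro exI[of _ B] exI[of _ C]) (simp del: assoc_mult_mat)
  then have "char_poly G = char_poly D" by (rule char_poly_similar)
  also have "\<dots> = (\<Prod>a\<leftarrow>diag_mat D. [:- a, 1:])"
    by (rule char_poly_upper_triangular[OF car(3)]) (auto simp: upper_triangular_def D_def)
  also have "\<dots> = (\<Prod>l<d. [:- form M y (e l), 1:])"
    unfolding diag_mat_def
    by (simp add: D_def prod.distinct_set_conv_list[symmetric] atLeast0LessThan o_def)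
  also have "\<dots> = (\<Prod>z\<in>spectrum. [:- form M y z, 1:])"
    by (rule prod.reindex_bij_betw[OF e])
  also have "char_poly G = map_poly (ev y) (char_poly (row_mat M))"
    unfolding G_def by (rule ev.char_poly_hom[of _ d]) (simp add: row_mat_def)
  finally show ?thesis .
qed

lemma card_row_zeros_le:
  assumes "y \<in> spectrum" "y' \<in> spectrum"
  shows "card {z \<in> spectrum. form M y z = 0} \<le> card {z \<in> spectrum. form M y' z = 0}"
proof (rule ccontr)
  \<comment> \<open>The index is the number of zeros in row \<open>y'\<close>, so this is the lowest
    coefficient that is nonzero at \<open>y'\<close>. With more zeros in row \<open>y\<close> it
    would vanish at \<open>y\<close>, contradicting \<open>ev_transfer\<close>.\<close>
  define c where "c = coeff (char_poly (row_mat M)) (card {z \<in> spectrum. form M y' z = 0})"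
  assume "\<not> ?thesis"
  then have "ev y c = 0"
    using coeff_prod_linear_factors(1)[OF finite_spectrum, of _ "form M y"]
    by (simp add: c_def char_poly_row_mat[symmetric] coeff_map_poly)
  moreover have "ev y' c \<noteq> 0"
    using coeff_prod_linear_factors(2)[OF finite_spectrum, of "form M y'"]
    by (simp add: c_def char_poly_row_mat[symmetric] coeff_map_poly)
  ultimately show False using ev_transfer assms by blast
qed

lemma card_row_support:
  assumes "y \<in> spectrum" "y' \<in> spectrum"
  shows "card {z \<in> spectrum. form M y z \<noteq> 0} = card {z \<in> spectrum. form M y' z \<noteq> 0}"
proof -
  have "card {z \<in> spectrum. form M x z \<noteq> 0} = d - card {z \<in> spectrum. form M x z = 0}" for x
    by (subst card_spectrum[symmetric], subst card_Diff_subset[symmetric])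
       (auto intro!: arg_cong[of _ _ card])
  then show ?thesis
    using card_row_zeros_le[OF assms, of M] card_row_zeros_le[OF assms(2,1), of M] by simp
qed

text \<open>For a set \<open>I\<close> of eigenvalues, the w(y) with y outside \<open>I\<close> cut
  out the span of the v(z) with z in \<open>I\<close>. So the condition says that \<open>M\<close>
  maps this span into itself.\<close>

definition preserves :: "complex set \<Rightarrow> int mat \<Rightarrow> bool" where
  "preserves I M \<longleftrightarrow> M \<in> carrier_mat d d \<and> (\<forall>y\<in>spectrum - I. \<forall>z\<in>I. form M y z = 0)"

definition reach :: "complex set \<Rightarrow> (complex \<times> complex) set" where
  "reach I = {(y, z). y \<in> spectrum \<and> z \<in> spectrum \<and> (\<exists>M. preserves I M \<and> form M y z \<noteq> 0)}"

text \<open>\<open>reach\<close> allows a different matrix for each pair; here one matrix serves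
  finitely many pairs at once. When a pair is added, an integer multiple of its matrix is added to
  the previous one, and each pair excludes at most one multiplier.\<close>

lemma preserves_generic:
  assumes "finite F" "F \<subseteq> reach I"
  shows "\<exists>M. preserves I M \<and> (\<forall>(y, z)\<in>F. form M y z \<noteq> 0)"
  using assms
proof (induction F rule: finite_induct)
  case empty
  have "preserves I (0\<^sub>m d d)" by (simp add: preserves_def form_def)
  then show ?case by blast
next
  case (insert p F)
  obtain M where M: "preserves I M" "\<forall>(y, z)\<in>F. form M y z \<noteq> 0"
    using insert by blast
  obtain N where N: "preserves I N" "form N (fst p) (snd p) \<noteq> 0"
    using insert.prems by (auto simp: reach_def)
  have car: "M \<in> carrier_mat d d" "N \<in> carrier_mat d d"
    using M N by (auto simp: preserves_def)
  \<comment> \<open>A multiplier that cancels an entry equals the quotient, hence also the floor of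
    its real part. Where \<open>form N y z = 0\<close> the quotient is 0 by convention, which merely
    excludes the multiplier 0 as well.\<close>
  define bad :: "int set" where
    "bad = (\<lambda>(y, z). \<lfloor>Re (- form M y z / form N y z)\<rfloor>) ` insert p F"
  have "finite bad" using insert.hyps by (simp add: bad_def)
  then obtain a where a: "a \<notin> bad" using ex_new_if_finite infinite_UNIV_int by blast
  have form: "form (M + a \<cdot>\<^sub>m N) y z = form M y z + of_int a * form N y z" for y z
    using car by (simp add: form_add form_smult)
  have "preserves I (M + a \<cdot>\<^sub>m N)"
    using M(1) N(1) car by (auto simp: preserves_def form)
  moreover have "form (M + a \<cdot>\<^sub>m N) y z \<noteq> 0" if "(y, z) \<in> insert p F" for y z
  proof (cases "form N y z = 0")
    case True
    then have "(y, z) \<in> F" using that N(2) by auto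
    then show ?thesis using M(2) True by (auto simp: form)
  next
    case False
    show ?thesis
    proof
      assume "form (M + a \<cdot>\<^sub>m N) y z = 0"
      then have "complex_of_int a = - form M y z / form N y z"
        using False by (simp add: form divide_simps eq_neg_iff_add_eq_0 add.commute)
      then have "a = \<lfloor>Re (- form M y z / form N y z)\<rfloor>"
        by (metis Re_complex_of_real floor_of_int of_real_of_int_eq)
      then show False using a that by (force simp: bad_def)
    qed
  qed
  ultimately show ?case by blast
qed

text \<open>In the sum over u of \<open>form_mult\<close> the first factor vanishes for u in
  \<open>I\<close>, the second for u outside \<open>I\<close>.\<close>

lemma preserves_mult:
  assumes "preserves I M" "preserves I N"
  shows "preserves I (M * N)"
proof -
  have "form (M * N) y z = 0" if "y \<in> spectrum - I" "z \<in> I" for y z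
  proof -
    have "form M y u * form N u z / pairing u = 0" if "u \<in> spectrum" for u
      using that assms \<open>y \<in> spectrum - I\<close> \<open>z \<in> I\<close> by (cases "u \<in> I") (auto simp: preserves_def)
    then show ?thesis using assms by (simp add: preserves_def form_mult)
  qed
  then show ?thesis using assms by (auto simp: preserves_def)
qed

lemma form_mult_pow_S:
  assumes "M \<in> carrier_mat d d" "z \<in> spectrum"
  shows "form (M * S ^\<^sub>m k) y z = form M y z * z ^ k"
proof (induction k)
  case 0
  then show ?case using assms S by simp
next
  case (Suc k)
  have "M * S ^\<^sub>m Suc k = M * S ^\<^sub>m k * S"
    using assoc_mult_mat[OF assms(1) pow_S_carrier S] by simp
  then show ?case
    using Suc form_mult_S[of "M * S ^\<^sub>m k" z y] assms pow_S_carrier[of k] by simp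
qed

lemma preserves_mult_pow_S:
  assumes "I \<subseteq> spectrum" "preserves I M"
  shows "preserves I (M * S ^\<^sub>m k)"
  using assms pow_S_carrier[of k] by (auto simp: preserves_def form_mult_pow_S subset_iff)

text \<open>The terms of \<open>form (M * N) x z\<close> may cancel although the one at
  \<open>y\<close> is nonzero. A power of \<open>S\<close> between the factors weights the term at u
  by that power of u, and by the Vandermonde argument some power leaves a nonzero sum.\<close>

lemma trans_reach:
  assumes I: "I \<subseteq> spectrum"
  shows "trans (reach I)"
proof (rule transI)
  fix x y z assume "(x, y) \<in> reach I" "(y, z) \<in> reach I"
  then obtain M N where xyz: "x \<in> spectrum" "y \<in> spectrum" "z \<in> spectrum"
    and M: "preserves I M" "form M x y \<noteq> 0" and N: "preserves I N" "form N y z \<noteq> 0"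
    by (auto simp: reach_def)
  define c where "c u = form M x u * form N u z / pairing u" for u
  have "c y \<noteq> 0" using M N xyz pairing_neq_0 by (simp add: c_def)
  then obtain k where k: "(\<Sum>u\<in>spectrum. c u * u ^ k) \<noteq> 0"
    using power_sums_eq_0_imp[of spectrum c y] xyz by auto
  have "form (M * S ^\<^sub>m k * N) x z = (\<Sum>u\<in>spectrum. form (M * S ^\<^sub>m k) x u * form N u z / pairing u)"
    using M N pow_S_carrier[of k] by (intro form_mult) (auto simp: preserves_def)
  also have "\<dots> = (\<Sum>u\<in>spectrum. c u * u ^ k)"
    using M by (intro sum.cong) (simp_all add: form_mult_pow_S preserves_def c_def)
  finally have "form (M * S ^\<^sub>m k * N) x z \<noteq> 0" using k by simp
  moreover have "preserves I (M * S ^\<^sub>m k * N)"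
    using preserves_mult preserves_mult_pow_S I M N by blast
  ultimately show "(x, z) \<in> reach I" using xyz by (auto simp: reach_def)
qed

lemma commute_if_preserves:
  assumes I: "I \<subseteq> spectrum" and T: "preserves I T" and gcd: "gcd d (card I) = 1"
  shows "S * T = T * S"
proof -
  have sub: "reach I \<subseteq> spectrum \<times> spectrum" by (auto simp: reach_def)
  then have "finite (reach I)" by (rule finite_subset) simp
  then obtain M where M: "preserves I M" "\<forall>(y, z)\<in>reach I. form M y z \<noteq> 0"
    using preserves_generic by blast
  \<comment> \<open>The rows of the relation are the row supports of the single matrix
    \<open>M\<close>, so \<open>card_row_support\<close> gives them all the same size.\<close>
  have row: "reach I `` {y} = {z \<in> spectrum. form M y z \<noteq> 0}" if "y \<in> spectrum" for y
    using M that by (auto simp: reach_def)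
  obtain x where x: "x \<in> spectrum" using card_spectrum d_pos by fastforce
  define r where "r = card (reach I `` {x})"
  have r: "card (reach I `` {y}) = r" if "y \<in> spectrum" for y
    unfolding r_def row[OF that] row[OF x] using that x by (rule card_row_support)
  have one: "preserves I (1\<^sub>m d)" using I by (auto simp: preserves_def form_one subset_iff)
  have refl: "(y, y) \<in> reach I" if "y \<in> spectrum" for y
    using that one pairing_neq_0 by (auto simp: reach_def form_one intro!: exI[of _ "1\<^sub>m d"])
  note dvd = dvd_card_closed_set[OF finite_spectrum sub refl trans_reach[OF I] r]
  \<comment> \<open>The complement of \<open>I\<close> is closed under \<open>reach I\<close>: a
    pair leading from outside \<open>I\<close> into \<open>I\<close> has \<open>form\<close> zero
    for every preserving matrix.\<close>
  have "r dvd card (spectrum - I)"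
    by (rule dvd) (auto simp: reach_def preserves_def)
  moreover have "r dvd d"
    using dvd[of spectrum] sub by (auto simp: card_spectrum)
  moreover have "card (spectrum - I) + card I = d"
    using I by (metis card_Diff_subset card_mono card_spectrum finite_spectrum finite_subset le_add_diff_inverse2)
  ultimately have "r dvd card I" by (metis dvd_add_right_iff)
  with \<open>r dvd d\<close> gcd have "r = 1" by (metis gcd_greatest nat_dvd_1_iff_1)
  \<comment> \<open>Rows have one element and contain their own index, so an off-diagonal nonzero
    entry of \<open>T\<close> would make a row too large.\<close>
  have diag: "form T y z = 0" if "y \<in> spectrum" "z \<in> spectrum" "y \<noteq> z" for y z
  proof (rule ccontr)
    assume "form T y z \<noteq> 0"
    then have "{y, z} \<subseteq> reach I `` {y}" using that T refl by (auto simp: reach_def)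
    then have "card {y, z} \<le> r" using r[OF that(1)] sub by (metis card_mono finite_Image \<open>finite (reach I)\<close>)
    then show False using that \<open>r = 1\<close> by simp
  qed
  have car: "T \<in> carrier_mat d d" using T by (simp add: preserves_def)
  show ?thesis
  proof (rule form_eqI)
    show "form (S * T) y z = form (T * S) y z" if "y \<in> spectrum" "z \<in> spectrum" for y z
      using diag that car by (cases "y = z") (simp_all add: form_S_mult form_mult_S)
  qed (use car S in auto)
qed

section \<open>The weak stable subspace\<close>

interpretation vs: vec_space "TYPE(real)" d .

definition stable :: "complex set" where
  "stable = {z \<in> spectrum. cmod z \<le> 1}"

text \<open>The weak stable subspace described by equations instead of generators: one complex
  equation for each eigenvalue of modulus above 1.\<close>

definition annihilator :: "real vec set" where
  "annihilator = {x \<in> carrier_vec d. \<forall>y\<in>spectrum - stable. (\<Sum>i<d. w i y * of_real (x $ i)) = 0}"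

text \<open>For a pair of conjugate eigenvalues, the real part of the eigenvector is attached to the one in the
  upper half plane and the imaginary part to the other, which gives one real vector per eigenvalue.\<close>

definition real_eigenvector :: "complex \<Rightarrow> real vec" where
  "real_eigenvector z = vec d (\<lambda>i. if Im z \<ge> 0 then Re (v i z) else Im (v i z))"

lemma stable_subset: "stable \<subseteq> spectrum" by (auto simp: stable_def)

lemma finite_stable [simp]: "finite stable" using stable_subset by (rule finite_subset) simp

lemma cnj_stable: "z \<in> stable \<Longrightarrow> cnj z \<in> stable"
  by (simp add: stable_def cnj_spectrum)

lemma real_eigenvector_carrier [simp]: "real_eigenvector z \<in> carrier_vec d"
  by (simp add: real_eigenvector_def)

lemma eigenvalue_iff: "eigenvalue (map_mat complex_of_int S) z \<longleftrightarrow> z \<in> spectrum"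
proof -
  have "map_mat complex_of_int S \<in> carrier_mat d d" using S by simp
  then show ?thesis
    using of_int_hom.char_poly_hom[OF S, where 'a = complex]
    by (simp add: eigenvalue_root_char_poly spectrum_altdef)
qed

lemma weak_stable_eq: "weak_stable S = vs.span (\<Union>z\<in>stable. gen_eigenspace S z)"
  using S by (simp add: weak_stable_def eigenvalue_iff stable_def)

lemma gen_eigenspace_carrier: "gen_eigenspace S z \<subseteq> carrier_vec d"
  using S by (auto simp: gen_eigenspace_def)

lemma mult_mat_vec_index:
  "i < d \<Longrightarrow> x \<in> carrier_vec d \<Longrightarrow> (map_mat f S *\<^sub>v x) $ i = (\<Sum>j<d. f (S $$ (i, j)) * x $ j)"
  using S by (simp add: scalar_prod_def atLeast0LessThan)

text \<open>The argument of \<open>pairing_eq_0\<close> for an arbitrary eigenvector in place of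
  v(z), as required by the definition of \<open>gen_eigenspace\<close>.\<close>

lemma left_eigenvector_orthogonal:
  assumes x: "x \<in> carrier_vec d" "map_mat complex_of_int S *\<^sub>v x = z \<cdot>\<^sub>v x"
    and y: "y \<in> spectrum" "y \<noteq> z"
  shows "(\<Sum>i<d. w i y * x $ i) = 0"
proof -
  have "z * (\<Sum>i<d. w i y * x $ i) = (\<Sum>i<d. w i y * (map_mat complex_of_int S *\<^sub>v x) $ i)"
    unfolding x(2) using x(1) by (simp add: sum_distrib_left ac_simps)
  also have "\<dots> = (\<Sum>i<d. w i y * (\<Sum>j<d. of_int (S $$ (i, j)) * x $ j))"
    using x(1) by (simp add: mult_mat_vec_index)
  also have "\<dots> = (\<Sum>j<d. (\<Sum>i<d. w i y * of_int (S $$ (i, j))) * x $ j)"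
    unfolding sum_distrib_left sum_distrib_right by (subst sum.swap) (simp add: mult.assoc)
  also have "\<dots> = y * (\<Sum>i<d. w i y * x $ i)"
    using y by (simp add: left_eigenvector sum_distrib_left mult.assoc)
  finally show ?thesis using y(2) by simp
qed

lemma gen_eigenspace_subset_annihilator:
  assumes z: "z \<in> stable"
  shows "gen_eigenspace S z \<subseteq> annihilator"
proof
  fix x assume x: "x \<in> gen_eigenspace S z"
  then have car: "x \<in> carrier_vec d" using gen_eigenspace_carrier by blast
  have "(\<Sum>i<d. w i y * of_real (x $ i)) = 0" if y: "y \<in> spectrum - stable" for y
  proof -
    \<comment> \<open>Conjugation preserves \<open>stable\<close>, so an unstable \<open>y\<close>
      differs from both eigenvalues that enter the generalized eigenspace.\<close>
    have ne: "y \<noteq> z" "y \<noteq> cnj z" using y z cnj_stable by auto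
    show ?thesis
    proof (cases "z \<in> \<real>")
      case True
      then have "map_mat real_of_int S *\<^sub>v x = Re z \<cdot>\<^sub>v x" and z': "z = of_real (Re z)"
        using x by (auto simp: gen_eigenspace_def)
      then have eq: "(\<Sum>j<d. of_int (S $$ (i, j)) * x $ j) = Re z * x $ i" if "i < d" for i
        using mult_mat_vec_index[OF that car, of real_of_int] car that by simp
      have "map_mat complex_of_int S *\<^sub>v map_vec of_real x = z \<cdot>\<^sub>v map_vec of_real x"
      proof (rule eq_vecI)
        fix i assume "i < dim_vec (z \<cdot>\<^sub>v map_vec complex_of_real x)"
        then have i: "i < d" using car by simp
        have "(map_mat complex_of_int S *\<^sub>v map_vec of_real x) $ i =
            (\<Sum>j<d. of_int (S $$ (i, j)) * of_real (x $ j))"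
          using car by (subst mult_mat_vec_index[OF i]) auto
        also have "\<dots> = of_real (\<Sum>j<d. of_int (S $$ (i, j)) * x $ j)" by simp
        also have "\<dots> = (z \<cdot>\<^sub>v map_vec of_real x) $ i"
          using i car z' by (subst eq) auto
        finally show "(map_mat complex_of_int S *\<^sub>v map_vec of_real x) $ i = (z \<cdot>\<^sub>v map_vec of_real x) $ i" .
      qed (use S car in auto)
      from left_eigenvector_orthogonal[OF _ this, of y] show ?thesis
        using car y ne by simp
    next
      case False
      then obtain a b where a: "a \<in> carrier_vec d" "map_mat complex_of_int S *\<^sub>v a = z \<cdot>\<^sub>v a"
        and b: "b \<in> carrier_vec d" "map_mat complex_of_int S *\<^sub>v b = cnj z \<cdot>\<^sub>v b"
        and xab: "map_vec complex_of_real x = a + b"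
        using x S by (auto simp: gen_eigenspace_def)
      have "complex_of_real (x $ i) = a $ i + b $ i" if "i < d" for i
        using arg_cong[OF xab, of "\<lambda>x. x $ i"] that car a b by simp
      then have "(\<Sum>i<d. w i y * of_real (x $ i)) = (\<Sum>i<d. w i y * a $ i) + (\<Sum>i<d. w i y * b $ i)"
        by (simp add: distrib_left sum.distrib)
      then show ?thesis
        using left_eigenvector_orthogonal[OF a, of y] left_eigenvector_orthogonal[OF b, of y] y ne by simp
    qed
  qed
  then show "x \<in> annihilator" using car by (simp add: annihilator_def)
qed

lemma span_subset_annihilator:
  assumes X: "X \<subseteq> annihilator"
  shows "vs.span X \<subseteq> annihilator"
proof
  fix x assume "x \<in> vs.span X"
  then obtain a A where x: "x = vs.lincomb a A" and A: "finite A" "A \<subseteq> X"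
    using vs.in_spanE by blast
  have car: "A \<subseteq> carrier_vec d" using A X by (auto simp: annihilator_def)
  have "(\<Sum>i<d. w i y * of_real (x $ i)) = 0" if y: "y \<in> spectrum - stable" for y
  proof -
    have "(\<Sum>i<d. w i y * of_real (x $ i)) =
        (\<Sum>i<d. w i y * (\<Sum>b\<in>A. of_real (a b) * of_real (b $ i)))"
      by (intro sum.cong refl) (simp add: x vs.lincomb_index[OF _ car])
    also have "\<dots> = (\<Sum>b\<in>A. of_real (a b) * (\<Sum>i<d. w i y * of_real (b $ i)))"
      unfolding sum_distrib_left by (subst sum.swap) (simp add: ac_simps)
    also have "\<dots> = 0"
      using A X y by (intro sum.neutral) (auto simp: annihilator_def)
    finally show ?thesis .
  qed
  moreover have "x \<in> carrier_vec d" using x A car by simp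
  ultimately show "x \<in> annihilator" by (simp add: annihilator_def)
qed

text \<open>Real and imaginary parts in terms of a number and its conjugate, with
  \<open>v i (cnj z) = cnj (v i z)\<close>; the factors of the imaginary part are 1/(2i) and
  -1/(2i).\<close>

lemma real_eigenvector_index:
  assumes "i < d"
  shows "complex_of_real (real_eigenvector z $ i) =
    (if Im z \<ge> 0 then 1 / 2 else - \<i> / 2) * v i z + (if Im z \<ge> 0 then 1 / 2 else \<i> / 2) * v i (cnj z)"
  using assms by (auto simp: real_eigenvector_def v_cnj complex_eq_iff)

lemma real_eigenvector_in_gen_eigenspace:
  assumes z: "z \<in> spectrum"
  shows "real_eigenvector z \<in> gen_eigenspace S z"
proof (cases "z \<in> \<real>")
  case True
  then have z': "Im z = 0" by (simp add: complex_is_Real_iff)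
  have "map_mat real_of_int S *\<^sub>v real_eigenvector z = Re z \<cdot>\<^sub>v real_eigenvector z"
  proof (rule eq_vecI)
    fix i assume "i < dim_vec (Re z \<cdot>\<^sub>v real_eigenvector z)"
    then have i: "i < d" by (simp add: real_eigenvector_def)
    have "(map_mat real_of_int S *\<^sub>v real_eigenvector z) $ i = Re (\<Sum>j<d. of_int (S $$ (i, j)) * v j z)"
      using z' by (simp add: mult_mat_vec_index[OF i] real_eigenvector_def)
    also have "\<dots> = (Re z \<cdot>\<^sub>v real_eigenvector z) $ i"
      using i z z' by (subst right_eigenvector) (simp_all add: real_eigenvector_def)
    finally show "(map_mat real_of_int S *\<^sub>v real_eigenvector z) $ i = (Re z \<cdot>\<^sub>v real_eigenvector z) $ i" .
  qed (use S in \<open>auto simp: real_eigenvector_def\<close>)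
  then show ?thesis using True S by (simp add: gen_eigenspace_def)
next
  case False
  have eig: "map_mat complex_of_int S *\<^sub>v vec d (\<lambda>i. a * v i y) = y \<cdot>\<^sub>v vec d (\<lambda>i. a * v i y)"
    if "y \<in> spectrum" for a y
  proof (rule eq_vecI)
    fix i assume "i < dim_vec (y \<cdot>\<^sub>v vec d (\<lambda>i. a * v i y))"
    then have i: "i < d" by simp
    have "(map_mat complex_of_int S *\<^sub>v vec d (\<lambda>i. a * v i y)) $ i =
        a * (\<Sum>j<d. of_int (S $$ (i, j)) * v j y)"
      by (simp add: mult_mat_vec_index[OF i] sum_distrib_left ac_simps)
    then show "(map_mat complex_of_int S *\<^sub>v vec d (\<lambda>i. a * v i y)) $ i = (y \<cdot>\<^sub>v vec d (\<lambda>i. a * v i y)) $ i"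
      using i that by (simp add: right_eigenvector)
  qed (use S in auto)
  let ?a = "vec d (\<lambda>i. (if Im z \<ge> 0 then 1 / 2 else - \<i> / 2) * v i z)"
  let ?b = "vec d (\<lambda>i. (if Im z \<ge> 0 then 1 / 2 else \<i> / 2) * v i (cnj z))"
  have "map_vec complex_of_real (real_eigenvector z) = ?a + ?b"
  proof (rule eq_vecI)
    fix i assume "i < dim_vec (?a + ?b)"
    then have i: "i < d" by simp
    then show "map_vec complex_of_real (real_eigenvector z) $ i = (?a + ?b) $ i"
      using real_eigenvector_index[OF i] by (simp add: real_eigenvector_def)
  qed (simp add: real_eigenvector_def)
  then have "\<exists>a\<in>carrier_vec d. \<exists>b\<in>carrier_vec d. map_mat complex_of_int S *\<^sub>v a = z \<cdot>\<^sub>v a \<and>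
      map_mat complex_of_int S *\<^sub>v b = cnj z \<cdot>\<^sub>v b \<and> map_vec complex_of_real (real_eigenvector z) = a + b"
    by (intro bexI[of _ ?a] bexI[of _ ?b] conjI eig z cnj_spectrum) auto
  then show ?thesis using False S by (simp add: gen_eigenspace_def)
qed

lemma real_eigenvectors_independent:
  fixes c :: "complex \<Rightarrow> real"
  assumes c: "\<And>i. i < d \<Longrightarrow> (\<Sum>z\<in>spectrum. c z * real_eigenvector z $ i) = 0" and z: "z \<in> spectrum"
  shows "c z = 0"
proof -
  define \<alpha> where "\<alpha> z = (if Im z \<ge> 0 then 1 / 2 else - \<i> / 2)" for z
  define \<beta> where "\<beta> z = (if Im z \<ge> 0 then 1 / 2 else \<i> / 2)" for z
  \<comment> \<open>The coefficient of v(z) once conjugate terms are collected. For real z it is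
    \<open>c z\<close>; otherwise \<open>c z\<close> and \<open>c (cnj z)\<close> appear separately,
    up to nonzero real factors, as its real and imaginary parts, so both vanish with it.\<close>
  define e where "e z = of_real (c z) * \<alpha> z + of_real (c (cnj z)) * \<beta> (cnj z)" for z
  have bij: "bij_betw cnj spectrum spectrum"
    by (rule bij_betwI[of _ _ _ cnj]) (auto intro: cnj_spectrum)
  have "(\<Sum>z\<in>spectrum. e z * v i z) = 0" if "i < d" for i
  proof -
    have "(\<Sum>z\<in>spectrum. e z * v i z) =
        (\<Sum>z\<in>spectrum. of_real (c z) * \<alpha> z * v i z) + (\<Sum>z\<in>spectrum. of_real (c (cnj z)) * \<beta> (cnj z) * v i z)"
      by (simp add: e_def distrib_right sum.distrib)
    also have "(\<Sum>z\<in>spectrum. of_real (c (cnj z)) * \<beta> (cnj z) * v i z) =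
        (\<Sum>z\<in>spectrum. of_real (c z) * \<beta> z * v i (cnj z))"
      using sum.reindex_bij_betw[OF bij, of "\<lambda>z. of_real (c z) * \<beta> z * v i (cnj z)"] by simp
    also have "(\<Sum>z\<in>spectrum. of_real (c z) * \<alpha> z * v i z) + \<dots> =
        of_real (\<Sum>z\<in>spectrum. c z * real_eigenvector z $ i)"
      using that by (simp add: real_eigenvector_index \<alpha>_def \<beta>_def distrib_left sum.distrib mult.assoc)
    finally show ?thesis using c that by simp
  qed
  then have "e z = 0" using right_eigenvectors_independent z by blast
  moreover have "cnj z = z" if "Im z = 0" using that by (simp add: complex_eq_iff)
  ultimately show ?thesis
    by (cases "Im z" "0 :: real" rule: linorder_cases)
       (auto simp: e_def \<alpha>_def \<beta>_def complex_eq_iff)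
qed

lemma inj_on_real_eigenvector: "inj_on real_eigenvector spectrum"
proof (rule inj_onI, rule ccontr)
  fix y z assume yz: "y \<in> spectrum" "z \<in> spectrum" "real_eigenvector y = real_eigenvector z" "y \<noteq> z"
  define c :: "complex \<Rightarrow> real" where "c u = (if u = y then 1 else 0) - (if u = z then 1 else 0)" for u
  have "(\<Sum>u\<in>spectrum. c u * real_eigenvector u $ i) = 0" for i
  proof -
    have "(\<Sum>u\<in>spectrum. c u * real_eigenvector u $ i) =
        (\<Sum>u\<in>spectrum. (if u = y then real_eigenvector u $ i else 0) - (if u = z then real_eigenvector u $ i else 0))"
      by (intro sum.cong) (auto simp: c_def)
    then show ?thesis using yz by (simp add: sum_subtractf)
  qed
  then have "c y = 0" using real_eigenvectors_independent yz by blast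
  then show False using yz by (simp add: c_def)
qed

lemma lin_indpt_real_eigenvectors: "vs.lin_indpt (real_eigenvector ` stable)"
proof (rule vs.finite_lin_indpt2)
  fix a assume lc: "vs.lincomb a (real_eigenvector ` stable) = 0\<^sub>v d"
  have inj: "inj_on real_eigenvector stable"
    using inj_on_real_eigenvector stable_subset by (rule inj_on_subset)
  define c where "c z = (if z \<in> stable then a (real_eigenvector z) else 0)" for z
  have "(\<Sum>z\<in>spectrum. c z * real_eigenvector z $ i) = 0" if "i < d" for i
  proof -
    have "(\<Sum>z\<in>spectrum. c z * real_eigenvector z $ i) = (\<Sum>z\<in>stable. a (real_eigenvector z) * real_eigenvector z $ i)"
      using stable_subset by (intro sum.mono_neutral_cong_right) (auto simp: c_def)
    also have "\<dots> = vs.lincomb a (real_eigenvector ` stable) $ i"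
      using that inj by (subst vs.lincomb_index) (auto simp: sum.reindex)
    finally show ?thesis using lc that by simp
  qed
  then have c: "c z = 0" if "z \<in> spectrum" for z
    using real_eigenvectors_independent that by blast
  show "\<forall>x\<in>real_eigenvector ` stable. a x = 0"
  proof safe
    fix z assume "z \<in> stable"
    then show "a (real_eigenvector z) = 0" using c[of z] stable_subset by (auto simp: c_def)
  qed
qed auto

lemma zero_in_span: "0\<^sub>v d \<in> vs.span W"
  by (rule vs.in_spanI[of _ "\<lambda>_. 0" "{}"]) (simp_all add: vs.lincomb_def)

lemma sum_in_span:
  assumes W: "W \<subseteq> carrier_vec d" and "finite A" "\<And>z. z \<in> A \<Longrightarrow> f z \<in> vs.span W"
  shows "vec d (\<lambda>i. \<Sum>z\<in>A. f z $ i) \<in> vs.span W"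
  using assms(2,3)
proof (induction A rule: finite_induct)
  case empty
  have "vec d (\<lambda>i. 0 :: real) = 0\<^sub>v d" by auto
  then show ?case using zero_in_span by simp
next
  case (insert z A)
  then have "f z \<in> carrier_vec d" using vs.span_closed[OF W] by auto
  then have "vec d (\<lambda>i. \<Sum>z\<in>insert z A. f z $ i) = f z + vec d (\<lambda>i. \<Sum>z\<in>A. f z $ i)"
    using insert.hyps by (intro eq_vecI) auto
  then show ?case using insert vs.span_add1[OF W] by auto
qed

lemma Re_Im_in_span:
  assumes z: "z \<in> stable"
  shows "vec d (\<lambda>i. Re (v i z)) \<in> vs.span (real_eigenvector ` stable)"
    and "vec d (\<lambda>i. Im (v i z)) \<in> vs.span (real_eigenvector ` stable)"
proof -
  have W: "real_eigenvector ` stable \<subseteq> carrier_vec d" by auto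
  have mem: "real_eigenvector y \<in> vs.span (real_eigenvector ` stable)" if "y \<in> stable" for y
    using vs.in_own_span[OF W] that by blast
  show "vec d (\<lambda>i. Re (v i z)) \<in> vs.span (real_eigenvector ` stable)"
  proof (cases "Im z \<ge> 0")
    case True
    then show ?thesis using mem[OF z] by (simp add: real_eigenvector_def)
  next
    case False
    then show ?thesis using mem[OF cnj_stable[OF z]] by (simp add: real_eigenvector_def v_cnj)
  qed
  show "vec d (\<lambda>i. Im (v i z)) \<in> vs.span (real_eigenvector ` stable)"
  proof (cases "Im z" "0 :: real" rule: linorder_cases)
    case less
    then show ?thesis using mem[OF z] by (simp add: real_eigenvector_def)
  next
    case equal
    then have "cnj z = z" by (simp add: complex_eq_iff)
    then have "Im (v i z) = 0" for i using arg_cong[OF v_cnj[of i z], of Im] by simp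
    then have "vec d (\<lambda>i. Im (v i z)) = 0\<^sub>v d" by auto
    then show ?thesis using zero_in_span by simp
  next
    case greater
    then have "vec d (\<lambda>i. Im (v i z)) = (- 1) \<cdot>\<^sub>v real_eigenvector (cnj z)"
      by (intro eq_vecI) (auto simp: real_eigenvector_def v_cnj)
    then show ?thesis using vs.smult_in_span[OF W mem[OF cnj_stable[OF z]]] by simp
  qed
qed

text \<open>In the complex eigenvector expansion of a real vector the unstable coefficients vanish
  by assumption. Taking real parts leaves a real combination of real and imaginary parts of stable
  eigenvectors.\<close>

lemma annihilator_subset_span: "annihilator \<subseteq> vs.span (real_eigenvector ` stable)"
proof
  fix x assume x: "x \<in> annihilator"
  then have car: "x \<in> carrier_vec d" by (simp add: annihilator_def)
  have W: "real_eigenvector ` stable \<subseteq> carrier_vec d" by auto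
  define a where "a z = (\<Sum>j<d. w j z * of_real (x $ j)) / pairing z" for z
  define f where "f z = Re (a z) \<cdot>\<^sub>v vec d (\<lambda>i. Re (v i z)) + (- Im (a z)) \<cdot>\<^sub>v vec d (\<lambda>i. Im (v i z))" for z
  have "x $ i = (\<Sum>z\<in>stable. f z $ i)" if i: "i < d" for i
  proof -
    have "complex_of_real (x $ i) = (\<Sum>z\<in>spectrum. a z * v i z)"
      unfolding a_def using i by (rule eigenvector_expansion)
    also have "\<dots> = (\<Sum>z\<in>stable. a z * v i z)"
      using x stable_subset by (intro sum.mono_neutral_right) (auto simp: a_def annihilator_def)
    finally have "x $ i = Re (\<Sum>z\<in>stable. a z * v i z)" by (metis Re_complex_of_real)
    then show ?thesis using i by (simp add: f_def)
  qed
  then have "x = vec d (\<lambda>i. \<Sum>z\<in>stable. f z $ i)" using car by auto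
  moreover have "f z \<in> vs.span (real_eigenvector ` stable)" if "z \<in> stable" for z
    unfolding f_def by (intro vs.span_add1[OF W] vs.smult_in_span[OF W] Re_Im_in_span that)
  ultimately show "x \<in> vs.span (real_eigenvector ` stable)"
    using sum_in_span[OF W finite_stable, of f] by simp
qed

text \<open>The span of the real eigenvectors lies in \<open>weak_stable S\<close>, this in
  \<open>annihilator\<close>, and this in the span again.\<close>

lemma weak_stable_eq_annihilator: "weak_stable S = annihilator"
  and weak_stable_eq_span: "weak_stable S = vs.span (real_eigenvector ` stable)"
proof -
  have "vs.span (real_eigenvector ` stable) \<subseteq> weak_stable S"
    unfolding weak_stable_eq using real_eigenvector_in_gen_eigenspace stable_subset
    by (intro vs.span_is_monotone) blast
  moreover have "weak_stable S \<subseteq> annihilator"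
    unfolding weak_stable_eq using gen_eigenspace_subset_annihilator
    by (intro span_subset_annihilator) blast
  ultimately show "weak_stable S = annihilator" "weak_stable S = vs.span (real_eigenvector ` stable)"
    using annihilator_subset_span by auto
qed

lemma dim_weak_stable: "subspace_dim d (weak_stable S) = card stable"
proof -
  let ?U = "real_eigenvector ` stable"
  have "subspace_dim d (weak_stable S) = card ?U"
    unfolding subspace_dim_def weak_stable_eq_span
  proof (rule vs.dim_span)
    show "maximal ?U (\<lambda>T. T \<subseteq> ?U \<and> vs.lin_indpt T)"
      using lin_indpt_real_eigenvectors by (auto simp: maximal_def)
  qed auto
  also have "\<dots> = card stable"
    using inj_on_real_eigenvector stable_subset by (intro card_image) (rule inj_on_subset)
  finally show ?thesis .
qed

text \<open>Each defining equation is a left eigenvector, so \<open>S\<close> only multiplies it by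
  its eigenvalue.\<close>

lemma weak_stable_invariant:
  assumes x: "x \<in> weak_stable S"
  shows "map_mat real_of_int S *\<^sub>v x \<in> weak_stable S"
proof -
  have car: "x \<in> carrier_vec d" using x by (simp add: weak_stable_eq_annihilator annihilator_def)
  have "(\<Sum>i<d. w i y * of_real ((map_mat real_of_int S *\<^sub>v x) $ i)) = 0" if y: "y \<in> spectrum - stable" for y
  proof -
    have "(\<Sum>i<d. w i y * of_real ((map_mat real_of_int S *\<^sub>v x) $ i)) =
        (\<Sum>i<d. w i y * (\<Sum>j<d. of_int (S $$ (i, j)) * of_real (x $ j)))"
      by (simp add: mult_mat_vec_index[OF _ car])
    also have "\<dots> = (\<Sum>j<d. (\<Sum>i<d. w i y * of_int (S $$ (i, j))) * of_real (x $ j))"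
      unfolding sum_distrib_left sum_distrib_right by (subst sum.swap) (simp add: mult.assoc)
    also have "\<dots> = y * (\<Sum>j<d. w j y * of_real (x $ j))"
      using y by (simp add: left_eigenvector sum_distrib_left mult.assoc)
    also have "\<dots> = 0" using x y by (simp add: weak_stable_eq_annihilator annihilator_def)
    finally show ?thesis .
  qed
  then show ?thesis
    using S car by (auto simp: weak_stable_eq_annihilator annihilator_def intro: mult_mat_vec_carrier)
qed

text \<open>Real and imaginary parts of a stable v(z) lie in the real subspace, so its invariance
  passes to v(z) by complex linearity.\<close>

lemma preserves_stable:
  assumes T: "T \<in> carrier_mat d d"
    and inv: "\<And>x. x \<in> weak_stable S \<Longrightarrow> map_mat real_of_int T *\<^sub>v x \<in> weak_stable S"
  shows "preserves stable T"
proof -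
  have "form T y z = 0" if y: "y \<in> spectrum - stable" and z: "z \<in> stable" for y z
  proof -
    have 0: "(\<Sum>i<d. w i y * (\<Sum>j<d. of_int (T $$ (i, j)) * of_real (f j))) = 0"
      if "vec d f \<in> weak_stable S" for f
    proof -
      have "(\<Sum>i<d. w i y * of_real ((map_mat real_of_int T *\<^sub>v vec d f) $ i)) = 0"
        using inv[OF that] y by (simp add: weak_stable_eq_annihilator annihilator_def)
      then show ?thesis using T by (simp add: scalar_prod_def atLeast0LessThan)
    qed
    have "v j z = of_real (Re (v j z)) + \<i> * of_real (Im (v j z))" for j
      by (rule complex_eq)
    then have "form T y z = (\<Sum>i<d. w i y * (\<Sum>j<d. of_int (T $$ (i, j)) *
        (of_real (Re (v j z)) + \<i> * of_real (Im (v j z)))))"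
      unfolding form_def by presburger
    also have "\<dots> = (\<Sum>i<d. w i y * (\<Sum>j<d. of_int (T $$ (i, j)) * of_real (Re (v j z)))) +
        \<i> * (\<Sum>i<d. w i y * (\<Sum>j<d. of_int (T $$ (i, j)) * of_real (Im (v j z))))"
      by (simp only: distrib_left sum.distrib sum_distrib_left mult.left_commute[of _ \<i>])
    finally show ?thesis
      using 0 Re_Im_in_span[OF z] by (simp add: weak_stable_eq_span)
  qed
  then show ?thesis using T by (simp add: preserves_def)
qed

section \<open>Moduli of the eigenvalues\<close>

text \<open>At 0 the characteristic matrix becomes \<open>- S\<close>.\<close>

lemma ev_0_char_poly: "\<bar>det S\<bar> = 1 \<Longrightarrow> cmod (ev 0 (char_poly S)) = 1"
proof -
  assume det: "\<bar>det S\<bar> = 1"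
  have "map_mat (ev 0) (char_poly_matrix S) = (- 1) \<cdot>\<^sub>m map_mat complex_of_int S"
    by (rule eq_matI) (use S in \<open>auto simp: char_poly_matrix_def ev.hom_add\<close>)
  then have "ev 0 (char_poly S) = (- 1) ^ d * complex_of_int (det S)"
    using S by (simp add: char_poly_def ev.hom_det[symmetric] of_int_hom.hom_det)
  then have "cmod (ev 0 (char_poly S)) = of_int \<bar>det S\<bar>"
    by (simp add: norm_mult norm_power)
  then show ?thesis using det by simp
qed

lemma prod_cmod_spectrum:
  assumes "\<bar>det S\<bar> = 1"
  shows "(\<Prod>z\<in>spectrum. cmod z) = 1"
proof -
  have "poly (map_poly of_int (char_poly S)) 0 = (\<Prod>z\<in>spectrum. - z)"
  proof -
    have "(\<Prod>z\<in>spectrum. [:- z, 1:]) = map_poly complex_of_int (char_poly S)"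
      using complex_poly_decompose_rsquarefree[OF rsquarefree_char_poly]
      by (simp add: spectrum_altdef degree_char_poly monic_char_poly)
    then show ?thesis by (metis (no_types, lifting) poly_prod poly_pCons mult_zero_left add.right_neutral prod.cong)
  qed
  then show ?thesis
    using ev_0_char_poly[OF assms] by (simp add: ev_def prod_norm[symmetric])
qed

lemma stable_nonempty:
  assumes "\<bar>det S\<bar> = 1"
  shows "stable \<noteq> {}"
proof
  assume "stable = {}"
  then have "cmod z > 1" if "z \<in> spectrum" for z
    using that by (force simp: stable_def)
  moreover have "spectrum \<noteq> {}" using card_spectrum d_pos by auto
  ultimately have "(\<Prod>z\<in>spectrum. cmod z) > 1"
    by (intro less_1_prod) auto
  then show False using prod_cmod_spectrum[OF assms] by simp
qed

text \<open>The spectral decomposition of the powers of \<open>S\<close>, in which the exponent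
  enters only through powers of eigenvalues.\<close>

lemma pow_S_index:
  assumes "i < d" "j < d"
  shows "complex_of_int ((S ^\<^sub>m k) $$ (i, j)) = (\<Sum>z\<in>spectrum. z ^ k * (v i z * w j z / pairing z))"
proof -
  have "complex_of_int ((S ^\<^sub>m k) $$ (i, j)) =
      (\<Sum>b<d. if b = j then of_int ((S ^\<^sub>m k) $$ (i, b)) else 0)"
    using assms by simp
  also have "\<dots> = (\<Sum>b<d. of_int ((S ^\<^sub>m k) $$ (i, b)) * (\<Sum>z\<in>spectrum. v b z * w j z / pairing z))"
    using assms by (intro sum.cong) (simp_all add: resolution_of_identity)
  also have "\<dots> = (\<Sum>z\<in>spectrum. (\<Sum>b<d. of_int ((S ^\<^sub>m k) $$ (i, b)) * v b z) * (w j z / pairing z))"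
    unfolding sum_distrib_left sum_distrib_right by (subst sum.swap) (simp add: mult.assoc)
  also have "\<dots> = (\<Sum>z\<in>spectrum. z ^ k * (v i z * w j z / pairing z))"
    using assms by (simp add: pow_S_right_eigenvector mult.assoc)
  finally show ?thesis .
qed

lemma finite_range_pow_S:
  assumes "stable = spectrum"
  shows "finite (range (\<lambda>k. S ^\<^sub>m k))"
proof -
  \<comment> \<open>As all eigenvalues lie in the closed unit disc, \<open>K\<close> bounds the
    entries of every power. Integrality leaves only the finitely many matrices described by
    \<open>F\<close>.\<close>
  define K where "K = (\<lambda>(i, j). \<Sum>z\<in>spectrum. cmod (v i z * w j z / pairing z))"
  define F where "F = (\<Pi>\<^sub>E p\<in>{..<d} \<times> {..<d}. {- \<lceil>K p\<rceil>..\<lceil>K p\<rceil>})"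
  have "S ^\<^sub>m k \<in> mat d d ` F" for k
  proof
    define f where "f = restrict (\<lambda>p. (S ^\<^sub>m k) $$ p) ({..<d} \<times> {..<d})"
    show "S ^\<^sub>m k = mat d d f"
      using pow_S_carrier[of k] by (intro eq_matI) (auto simp: f_def)
    have "\<bar>(S ^\<^sub>m k) $$ (i, j)\<bar> \<le> \<lceil>K (i, j)\<rceil>" if "i < d" "j < d" for i j
    proof -
      have "real_of_int \<bar>(S ^\<^sub>m k) $$ (i, j)\<bar> = cmod (complex_of_int ((S ^\<^sub>m k) $$ (i, j)))"
        by simp
      also have "\<dots> \<le> (\<Sum>z\<in>spectrum. cmod (z ^ k * (v i z * w j z / pairing z)))"
        unfolding pow_S_index[OF that] by (rule norm_sum)
      also have "\<dots> \<le> (\<Sum>z\<in>spectrum. cmod (v i z * w j z / pairing z))"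
      proof (rule sum_mono)
        fix z assume "z \<in> spectrum"
        then have "cmod z \<le> 1" using assms by (auto simp: stable_def)
        then have "cmod z ^ k \<le> 1" by (simp add: power_le_one)
        then show "cmod (z ^ k * (v i z * w j z / pairing z)) \<le> cmod (v i z * w j z / pairing z)"
          unfolding norm_mult norm_power by (rule mult_left_le_one_le[rotated 2]) simp_all
      qed
      finally show ?thesis by (simp add: K_def le_ceiling_iff)
    qed
    then show "f \<in> F" unfolding f_def F_def
      by (auto simp: abs_le_iff minus_le_iff)
  qed
  moreover have "finite F" unfolding F_def by (intro finite_PiE) auto
  ultimately show ?thesis by (metis finite_imageI finite_subset image_subsetI)
qed

text \<open>Kronecker's argument: bounded powers of an integer matrix repeat.\<close>

lemma pow_S_eq_one:
  assumes "stable = spectrum" and det: "\<bar>det S\<bar> = 1"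
  shows "\<exists>m\<ge>1. S ^\<^sub>m m = 1\<^sub>m d"
proof -
  have "\<not> inj (\<lambda>k. S ^\<^sub>m k)"
    using finite_range_pow_S[OF assms(1)] by (metis finite_imageD infinite_UNIV_nat)
  then obtain k l where "k \<noteq> l" "S ^\<^sub>m k = S ^\<^sub>m l" by (auto simp: inj_def)
  then obtain k l where kl: "k < l" "S ^\<^sub>m k = S ^\<^sub>m l" by (metis linorder_neqE_nat)
  have "z ^ (l - k) = 1" if z: "z \<in> spectrum" for z
  proof -
    have "z ^ k * v 0 z = z ^ l * v 0 z"
      using pow_S_right_eigenvector[OF z d_pos, of k] pow_S_right_eigenvector[OF z d_pos, of l]
      unfolding kl(2) by (rule trans[OF sym])
    then have "z ^ k = z ^ l" using v_0_neq_0[OF z] by simp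
    also have "z ^ l = z ^ k * z ^ (l - k)" using kl(1) by (simp add: power_add[symmetric])
    finally have "z ^ k * z ^ (l - k) = z ^ k * 1" by simp
    moreover have "z \<noteq> 0" using z ev_0_char_poly[OF det] by (auto simp: spectrum_def)
    ultimately show ?thesis by simp
  qed
  then have "form (1\<^sub>m d * S ^\<^sub>m (l - k)) y z = form (1\<^sub>m d) y z" if "z \<in> spectrum" for y z
    using that form_mult_pow_S[of "1\<^sub>m d" z "l - k" y] by simp
  then have "form (S ^\<^sub>m (l - k)) y z = form (1\<^sub>m d) y z" if "z \<in> spectrum" for y z
    using that by (simp only: left_mult_one_mat[OF pow_S_carrier])
  then have "S ^\<^sub>m (l - k) = 1\<^sub>m d"
    using pow_S_carrier by (intro form_eqI) simp_all
  then show ?thesis using kl(1) by (intro exI[of _ "l - k"]) auto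
qed

end

section \<open>Total irreducibility and invertibility over the integers\<close>

lemma irreducible_one_mat:
  assumes "irreducible_int_mat (1\<^sub>m d)"
  shows "d = 1"
proof -
  interpret irreducible_matrix d "1\<^sub>m d" by unfold_locales (use assms in auto)
  have "z = 1" if z: "z \<in> spectrum" for z
  proof -
    have "z * v 0 z = (\<Sum>j<d. of_int (1\<^sub>m d $$ (0, j)) * v j z)"
      using right_eigenvector[OF z d_pos] by simp
    also have "\<dots> = (\<Sum>j<d. if j = 0 then v j z else 0)"
      using d_pos by (intro sum.cong) auto
    also have "\<dots> = v 0 z" using d_pos by simp
    finally show ?thesis using v_0_neq_0[OF z] by simp
  qed
  \<comment> \<open>An irreducible matrix has \<open>d\<close> distinct eigenvalues, but the
    identity has only the eigenvalue 1.\<close>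
  then have "spectrum \<subseteq> {1}" by blast
  then have "card spectrum \<le> card {1 :: complex}" by (intro card_mono) auto
  then show ?thesis using card_spectrum d_pos by simp
qed

lemma abs_det_GL_int:
  assumes "S \<in> GL_int d"
  shows "\<bar>det S\<bar> = 1"
proof -
  have S: "S \<in> carrier_mat d d" using assms by (simp add: GL_int_def)
  obtain B where B: "S * B = 1\<^sub>m d" "B * S = 1\<^sub>m (dim_row B)"
    using assms S by (auto simp: GL_int_def invertible_mat_def inverts_mat_def)
  \<comment> \<open>\<open>invertible_mat\<close> does not state the size of the inverse; it is read
    off from the two identity matrices.\<close>
  have "dim_col B = d" using arg_cong[OF B(1), of dim_col] by simp
  moreover have "dim_row B = d" using arg_cong[OF B(2), of dim_col] S by simp
  ultimately have "B \<in> carrier_mat d d" by auto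
  then have "det S * det B = 1" using B(1) det_mult[OF S, of B] by simp
  then show ?thesis by (auto simp: zmult_eq_1_iff)
qed

lemma irreducible_matrixI:
  assumes "S \<in> GL_int d" "totally_irreducible S"
  shows "irreducible_matrix d S"
proof
  show S: "S \<in> carrier_mat d d" using assms by (simp add: GL_int_def)
  have "irreducible_int_mat (S ^\<^sub>m 1)" using assms by (auto simp: totally_irreducible_def)
  then show "irreducible_int_mat S" using S by simp
qed

theorem theorem1p2:
  fixes d :: nat and S T :: "int mat"
  assumes "S \<in> GL_int d" and "T \<in> GL_int d"
    and "totally_irreducible S" and "totally_irreducible T"
    and "weak_stable S = weak_stable T"
  shows "(gcd d (subspace_dim d (weak_stable S)) = 1 \<longrightarrow> S * T = T * S) \<and>
         (Factorial_Ring.prime d \<longrightarrow> gcd d (subspace_dim d (weak_stable S)) = 1)"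
proof -
  interpret S: irreducible_matrix d S using assms by (intro irreducible_matrixI)
  interpret T: irreducible_matrix d T using assms by (intro irreducible_matrixI)
  have det: "\<bar>det S\<bar> = 1" using assms(1) by (rule abs_det_GL_int)
  \<comment> \<open>\<open>T\<close> keeps its own weak stable subspace invariant, and this is also
    that of \<open>S\<close>.\<close>
  have "S.preserves S.stable T"
    using T.weak_stable_invariant assms(5) by (intro S.preserves_stable T.S) simp
  then have "S * T = T * S" if "gcd d (subspace_dim d (weak_stable S)) = 1"
    using S.commute_if_preserves[OF S.stable_subset] that by (simp add: S.dim_weak_stable)
  moreover have "gcd d (card S.stable) = 1" if "Factorial_Ring.prime d"
  proof -
    have "S.stable \<noteq> S.spectrum"
    proof
      assume "S.stable = S.spectrum"
      then obtain m where "m \<ge> 1" "S ^\<^sub>m m = 1\<^sub>m d" using S.pow_S_eq_one det by blast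
      then have "irreducible_int_mat (1\<^sub>m d)" using assms(3) by (metis totally_irreducible_def)
      then show False using irreducible_one_mat that by (metis not_prime_1)
    qed
    then have "card S.stable < d"
      using S.stable_subset psubset_card_mono[OF S.finite_spectrum] by (metis S.card_spectrum psubsetI)
    moreover have "card S.stable > 0"
      using S.stable_nonempty[OF det] by (simp add: card_gt_0_iff)
    ultimately have "\<not> d dvd card S.stable" by (auto dest: dvd_imp_le)
    then show ?thesis using that by (simp add: prime_imp_coprime)
  qed
  ultimately show ?thesis by (simp add: S.dim_weak_stable)
qed

end
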